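(* Suppose that $0<s<1$ and $1<p<\infty$. Let $\omega$ be an $A_p$ weight in $\mathbb{R}^n$ such that $C^\infty_0(\mathbb{R}^n)$ is a subset of $W^{s,p,\omega}(\mathbb{R}^n)$. Then, for every $f\in W^{s,p,\omega}(\mathbb{R}^n)$, there is a $G_\delta$-set $E\subset\mathbb{R}^n$ such that $C_{s,p,\omega}(E)=0$ and the limit $$\lim_{r\to0_+}\frac{1}{|B(x,r)|}\int_{B(x,r)}f(y)\,dy=f^*(x)$$ exists for every $x\in\mathbb{R}^n\setminus E$. Moreover, for every $\varepsilon>0$, there exists an open set $U\subset\mathbb{R}^n$ such that $C_{s,p,\omega}(U)<\varepsilon$ and $f^*|_{\mathbb{R}^n\setminus U}$ is well-defined and continuous on $\mathbb{R}^n\setminus U$.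
   Context: A weight in $\mathbb{R}^n$ is a function $\omega\in L^1_{\mathrm{loc}}(\mathbb{R}^n)$ with $\omega>0$ almost everywhere. For $1<p<\infty$, it is an $A_p$ weight if there is $A>0$ such that $\big(\frac1{|Q|}\int_Q\omega\,dx\big)\big(\frac1{|Q|}\int_Q\omega^{-1/(p-1)}\,dx\big)^{p-1}\le A$ for every cube $Q\subset\mathbb{R}^n$. $W^{s,p,\omega}(\mathbb{R}^n)$ is the space of functions $f\in L^p(\mathbb{R}^n)$ with $\|f\|^p_{W^{s,p,\omega}(\mathbb{R}^n)}=\|f\|^p_{L^p(\mathbb{R}^n)}+|f|^p_{W^{s,p,\omega}(\mathbb{R}^n)}<\infty$, where $$|f|_{W^{s,p,\omega}(\mathbb{R}^n)}=\Big(\int_{\mathbb{R}^n}\int_{\mathbb{R}^n}\frac{|f(x)-f(y)|^p}{|x-y|^{sp}}\,\omega(x-y)\,dy\,dx\Big)^{1/p}.$$ The Sobolev capacity of a set $E\subset\mathbb{R}^n$ is $C_{s,p,\omega}(E)=\inf_{\varphi\in\mathcal{A}(E)}\|\varphi\|^p_{W^{s,p,\omega}(\mathbb{R}^n)}$, where $\mathcal{A}(E)=\{\varphi\in W^{s,p,\omega}(\mathbb{R}^n):\varphi\ge1\text{ in an open set containing }E\}$, and $C_{s,p,\omega}(E)=\infty$ if $\mathcal{A}(E)=\emptyset$. The function $f^*$ is defined as the displayed limit at each point where the limit exists (as a real number); "well-defined on $\mathbb{R}^n\setminus U$" means that the limit exists at every point of $\mathbb{R}^n\setminus U$. $B(x,r)$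 is the open ball. *)

theory Defs
  imports "HOL-Analysis.Analysis"
begin

definition weight :: "(real ^ 'n \<Rightarrow> real) \<Rightarrow> bool" where
  "weight \<omega> \<longleftrightarrow>
     (\<forall>K. compact K \<longrightarrow> set_integrable lebesgue K \<omega>) \<and>
     (AE x in lebesgue. \<omega> x > 0)"

definition cubes :: "(real ^ 'n) set set" where
  "cubes = {cbox a (\<chi> i. a $ i + l) | a l. l > 0}"

definition mean_on :: "(real ^ 'n) set \<Rightarrow> (real ^ 'n \<Rightarrow> real) \<Rightarrow> real" where
  "mean_on Q f = 1 / measure lebesgue Q * (LINT x:Q|lebesgue. f x)"

(* Integrability of \<omega> powr (-1/(p-1)) on Q is part of the condition: a bound on the product
   forces the second integral to be finite, whereas the Bochner integral of a
   non-integrable function is 0 by convention. *)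
definition A_p_weight :: "real \<Rightarrow> (real ^ 'n \<Rightarrow> real) \<Rightarrow> bool" where
  "A_p_weight p \<omega> \<longleftrightarrow> weight \<omega> \<and>
     (\<exists>A>0. \<forall>Q\<in>cubes.
        set_integrable lebesgue Q (\<lambda>x. \<omega> x powr (- 1 / (p - 1))) \<and>
        mean_on Q \<omega> * mean_on Q (\<lambda>x. \<omega> x powr (- 1 / (p - 1))) powr (p - 1) \<le> A)"

(* The p-th powers of the L^p norm, of the weighted seminorm and of the Sobolev norm,
   with values in [0,\<infinity>]; the p-th roots are never needed. *)
definition Lp_norm_pow :: "real \<Rightarrow> (real ^ 'n \<Rightarrow> real) \<Rightarrow> ennreal" where
  "Lp_norm_pow p f = (\<integral>\<^sup>+ x. ennreal (\<bar>f x\<bar> powr p) \<partial>lebesgue)"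

definition seminorm_pow ::
    "real \<Rightarrow> real \<Rightarrow> (real ^ 'n \<Rightarrow> real) \<Rightarrow> (real ^ 'n \<Rightarrow> real) \<Rightarrow> ennreal" where
  "seminorm_pow s p \<omega> f =
     (\<integral>\<^sup>+ x. (\<integral>\<^sup>+ y. ennreal (\<bar>f x - f y\<bar> powr p / norm (x - y) powr (s * p) * \<omega> (x - y))
        \<partial>lebesgue) \<partial>lebesgue)"

definition sobolev_norm_pow ::
    "real \<Rightarrow> real \<Rightarrow> (real ^ 'n \<Rightarrow> real) \<Rightarrow> (real ^ 'n \<Rightarrow> real) \<Rightarrow> ennreal" where
  "sobolev_norm_pow s p \<omega> f = Lp_norm_pow p f + seminorm_pow s p \<omega> f"

definition sobolev_space ::
    "real \<Rightarrow> real \<Rightarrow> (real ^ 'n \<Rightarrow> real) \<Rightarrow> (real ^ 'n \<Rightarrow> real) set" where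
  "sobolev_space s p \<omega> = {f \<in> borel_measurable lebesgue. sobolev_norm_pow s p \<omega> f < \<infinity>}"

primrec C_k :: "nat \<Rightarrow> (real ^ 'n \<Rightarrow> real) \<Rightarrow> bool" where
  "C_k 0 f \<longleftrightarrow> continuous_on UNIV f"
| "C_k (Suc k) f \<longleftrightarrow>
     (\<forall>x. f differentiable (at x)) \<and> (\<forall>v. C_k k (\<lambda>x. frechet_derivative f (at x) v))"

definition C0_infinity :: "(real ^ 'n \<Rightarrow> real) set" where
  "C0_infinity = {f. (\<forall>k. C_k k f) \<and> compact (closure {x. f x \<noteq> 0})}"

definition admissible ::
    "real \<Rightarrow> real \<Rightarrow> (real ^ 'n \<Rightarrow> real) \<Rightarrow> (real ^ 'n) set \<Rightarrow> (real ^ 'n \<Rightarrow> real) set" where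
  "admissible s p \<omega> E =
     {\<phi> \<in> sobolev_space s p \<omega>. \<exists>V. open V \<and> E \<subseteq> V \<and> (\<forall>x\<in>V. \<phi> x \<ge> 1)}"

(* The infimum over the empty set is \<infinity> in ennreal. *)
definition sobolev_capacity ::
    "real \<Rightarrow> real \<Rightarrow> (real ^ 'n \<Rightarrow> real) \<Rightarrow> (real ^ 'n) set \<Rightarrow> ennreal" where
  "sobolev_capacity s p \<omega> E = (INF \<phi>\<in>admissible s p \<omega> E. sobolev_norm_pow s p \<omega> \<phi>)"

definition has_star_limit :: "(real ^ 'n \<Rightarrow> real) \<Rightarrow> real ^ 'n \<Rightarrow> bool" where
  "has_star_limit f x \<longleftrightarrow> (\<exists>l. ((\<lambda>r. mean_on (ball x r) f) \<longlongrightarrow> l) (at_right 0))"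

(* Meaningful only at points where has_star_limit f x holds. *)
definition star :: "(real ^ 'n \<Rightarrow> real) \<Rightarrow> real ^ 'n \<Rightarrow> real" where
  "star f x = Lim (at_right 0) (\<lambda>r. mean_on (ball x r) f)"

end

theory Submission
  imports Defs
begin

text \<open>
  The kernel of the seminorm depends only on \<open>x - y\<close>, so by Tonelli the \<open>p\<close>-th power of the norm
  is \<open>\<parallel>f\<parallel>\<^sub>p\<^sup>p + \<integral> K(z) \<parallel>f - f(\<sqdot> - z)\<parallel>\<^sub>p\<^sup>p dz\<close>. Every sublinear translation-invariant operator
  bounded on unweighted \<open>L\<^sup>p\<close> is therefore bounded on the weighted space. Applied to the local
  Hardy-Littlewood maximal operator \<open>M\<close> this gives a weak-type capacitary estimate, because
  \<open>{Mf > t}\<close> is open and \<open>min 1 (Mf / t)\<close> is an admissible test function for it. Applied to the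
  averages \<open>f\<^sub>\<delta>(x)\<close> over \<open>B(x,\<delta>)\<close>, which are continuous, it gives \<open>f\<^sub>\<delta> \<rightarrow> f\<close> in the weighted space
  by dominated convergence in \<open>z\<close>. The exceptional set is the limsup of the level sets
  \<open>{M(f - f\<^sub>\<delta>\<^sub>i) > 2\<^sup>-\<^sup>i}\<close> for rapidly decreasing \<open>\<delta>\<^sub>i\<close>, and off the union
  of a tail of these the averages converge uniformly.
\<close>

section \<open>The local maximal operator: weak type\<close>

text \<open>What carries an operator through the seminorm is the pointwise inequality |Mf(x) - Mf(x
  - z)| \<le> M(f - f(. - z))(x): for each fixed z it reduces the matter to an unweighted bound,
  which is then integrated against the kernel. A tail of the exceptional set is a countable union of
  level sets, and one test function has to serve all of it. It is a supremum of truncated maximal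
  functions; since the p-th power of a supremum is at most the sum of the p-th powers, its energy is
  at most a constant times a sum of energies. Multiplying the i-th difference by 2^i moves every
  level to 1, so one truncation fits all indices, and it also turns the possibly infinite maximal
  functions into real ones. Radii are at most 1 because Vitali's covering lemma wants bounded radii;
  the limit of small averages sees no others. All estimates are for p-th powers of norms, with a
  triangle inequality that costs a factor 2^p. The analysis is done for Borel functions and
  \<open>lborel\<close>; passing to them changes no norm and no ball average.\<close>

definition local_maximal :: "('a::euclidean_space \<Rightarrow> ennreal) \<Rightarrow> 'a \<Rightarrow> ennreal" where
  "local_maximal u x =
     (SUP r\<in>{0<..1}. (\<integral>\<^sup>+y. u y * indicator (ball x r) y \<partial>lborel) / emeasure lborel (ball x r))"

lemma emeasure_lborel_ball_pos:
  "0 < r \<Longrightarrow> 0 < emeasure lborel (ball x r :: 'a::euclidean_space set)"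
  by (simp add: emeasure_ball)

lemma emeasure_lborel_ball_finite:
  "emeasure lborel (ball x r :: 'a::euclidean_space set) < \<infinity>"
  using emeasure_bounded_finite[OF bounded_ball] by simp

lemma emeasure_lborel_ball_cong:
  "0 \<le> r \<Longrightarrow> emeasure lborel (ball x r) = emeasure lborel (ball y r)"
  for x y :: "'a::euclidean_space"
  by (simp add: emeasure_ball)

lemma less_divide_ennreal: "b \<noteq> 0 \<Longrightarrow> b < \<infinity> \<Longrightarrow> c < a / b \<longleftrightarrow> c * b < a"
  for a b c :: ennreal
  by (cases a; cases b; cases c)
    (auto simp: divide_ennreal ennreal_mult[symmetric] ennreal_less_iff field_simps ennreal_top_mult
      ennreal_top_divide)

text \<open>Clearing the denominator turns the level condition into a comparison of two measures of
  one ball, so that continuity from below and additivity over disjoint balls apply to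
  \<open>density lborel u\<close>, even where it is infinite.\<close>

lemma local_maximal_less_iff:
  assumes u: "u \<in> borel_measurable (borel :: 'a::euclidean_space measure)"
  shows "c < local_maximal u x \<longleftrightarrow>
    (\<exists>r. 0 < r \<and> r \<le> 1 \<and> c * emeasure lborel (ball x r) < emeasure (density lborel u) (ball x r))"
proof -
  have "c < (\<integral>\<^sup>+y. u y * indicator (ball x r) y \<partial>lborel) / emeasure lborel (ball x r) \<longleftrightarrow>
    c * emeasure lborel (ball x r) < emeasure (density lborel u) (ball x r)" if "0 < r" for r
    using emeasure_lborel_ball_pos[OF that, of x] emeasure_lborel_ball_finite[of x r] u
    by (simp add: less_divide_ennreal emeasure_density)
  then show ?thesis
    unfolding local_maximal_def less_SUP_iff by (auto simp: Bex_def)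
qed

text \<open>The strict inequality between the two measures survives a slight shrinking of the ball,
  by continuity from below. The smaller ball lies in every ball of the original radius with a nearby
  centre, and the Lebesgue measure of a ball does not depend on its centre.\<close>

lemma open_local_maximal_gt:
  assumes u: "u \<in> borel_measurable (borel :: 'a::euclidean_space measure)"
  shows "open {x. c < local_maximal u x}"
proof (rule openI)
  fix x assume "x \<in> {x. c < local_maximal u x}"
  then obtain r where r: "0 < r" "r \<le> 1"
    and gt: "c * emeasure lborel (ball x r) < emeasure (density lborel u) (ball x r)"
    by (auto simp: local_maximal_less_iff[OF u])
  define a where "a k = r / real (Suc k)" for k
  have a_pos: "0 < a k" for k using r by (simp add: a_def)
  have a_decr: "a (Suc k) \<le> a k" for k
    unfolding a_def using r by (intro divide_left_mono) auto
  have un: "(\<Union>k. ball x (r - a k)) = ball x r"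
  proof (intro equalityI subsetI)
    fix y assume "y \<in> (\<Union>k. ball x (r - a k))"
    then obtain k where "dist x y < r - a k" by auto
    then show "y \<in> ball x r" using a_pos[of k] by simp
  next
    fix y assume "y \<in> ball x r"
    then have "0 < (r - dist x y) / r" using r by simp
    then obtain k where "inverse (real (Suc k)) < (r - dist x y) / r"
      using reals_Archimedean by blast
    then have "r * inverse (real (Suc k)) < r * ((r - dist x y) / r)"
      using r by (intro mult_strict_left_mono) auto
    also have "r * ((r - dist x y) / r) = r - dist x y" using r by simp
    finally have "a k < r - dist x y"
      unfolding a_def by (simp add: divide_inverse)
    then have "dist x y < r - a k" by linarith
    then show "y \<in> (\<Union>k. ball x (r - a k))" by auto
  qed
  have "incseq (\<lambda>k. ball x (r - a k))"
    using a_decr by (intro incseq_SucI subset_ball) (simp add: diff_left_mono)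
  then have "(SUP k. emeasure (density lborel u) (ball x (r - a k)))
      = emeasure (density lborel u) (ball x r)"
    unfolding un[symmetric] by (intro SUP_emeasure_incseq) auto
  then have "c * emeasure lborel (ball x r) < (SUP k. emeasure (density lborel u) (ball x (r - a k)))"
    using gt by simp
  then obtain k where k: "c * emeasure lborel (ball x r)
      < emeasure (density lborel u) (ball x (r - a k))"
    unfolding less_SUP_iff by blast
  show "\<exists>e>0. ball x e \<subseteq> {x. c < local_maximal u x}"
  proof (intro exI conjI subsetI CollectI)
    show "0 < a k" by (rule a_pos)
    fix y assume y: "y \<in> ball x (a k)"
    have "ball x (r - a k) \<subseteq> ball y r"
    proof
      fix w assume "w \<in> ball x (r - a k)"
      then show "w \<in> ball y r"
        using y dist_triangle[of y w x] by (simp add: dist_commute)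
    qed
    then have "emeasure (density lborel u) (ball x (r - a k))
      \<le> emeasure (density lborel u) (ball y r)"
      by (intro emeasure_mono) auto
    with k have "c * emeasure lborel (ball y r) < emeasure (density lborel u) (ball y r)"
      using emeasure_lborel_ball_cong[of r x y] r by simp
    then show "c < local_maximal u y"
      using r by (auto simp: local_maximal_less_iff[OF u])
  qed
qed

lemma borel_measurable_local_maximal [measurable]:
  assumes u: "u \<in> borel_measurable (borel :: 'a::euclidean_space measure)"
  shows "local_maximal u \<in> borel_measurable borel"
  by (rule borel_measurableI_greater) (simp add: open_local_maximal_gt[OF u])

lemma local_maximal_mono: "(\<And>x. u x \<le> v x) \<Longrightarrow> local_maximal u x \<le> local_maximal v x"
  unfolding local_maximal_def
  by (intro SUP_mono') (auto intro!: divide_right_mono_ennreal nn_integral_mono mult_right_mono)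

lemma local_maximal_add:
  assumes [measurable]: "u \<in> borel_measurable borel" "v \<in> borel_measurable borel"
  shows "local_maximal (\<lambda>y. u y + v y) x \<le> local_maximal u x + local_maximal v x"
proof -
  have "(\<integral>\<^sup>+y. (u y + v y) * indicator (ball x r) y \<partial>lborel) / emeasure lborel (ball x r)
     \<le> local_maximal u x + local_maximal v x" if "r \<in> {0<..1}" for r
  proof -
    have "(\<integral>\<^sup>+y. (u y + v y) * indicator (ball x r) y \<partial>lborel) / emeasure lborel (ball x r)
      = (\<integral>\<^sup>+y. u y * indicator (ball x r) y \<partial>lborel) / emeasure lborel (ball x r)
      + (\<integral>\<^sup>+y. v y * indicator (ball x r) y \<partial>lborel) / emeasure lborel (ball x r)"
      by (subst add_divide_distrib_ennreal[symmetric], subst nn_integral_add[symmetric])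
        (auto simp: distrib_right intro!: borel_measurable_times_ennreal borel_measurable_indicator)
    also have "\<dots> \<le> local_maximal u x + local_maximal v x"
      unfolding local_maximal_def using that by (intro add_mono SUP_upper)
    finally show ?thesis .
  qed
  then show ?thesis
    unfolding local_maximal_def[of "\<lambda>y. u y + v y"] by (rule SUP_least)
qed

lemma local_maximal_const: "local_maximal (\<lambda>y. c) x \<le> c"
  unfolding local_maximal_def
proof (rule SUP_least)
  fix r :: real assume "r \<in> {0<..1}"
  then have "0 < emeasure lborel (ball x r)" by (intro emeasure_lborel_ball_pos) auto
  then show "(\<integral>\<^sup>+y. c * indicator (ball x r) y \<partial>lborel) / emeasure lborel (ball x r) \<le> c"
    using emeasure_lborel_ball_finite[of x r]
    by (simp add: nn_integral_cmult_indicator ennreal_mult_divide_eq)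
qed

lemma nn_integral_lborel_shift:
  fixes f :: "'a::euclidean_space \<Rightarrow> ennreal"
  assumes [measurable]: "f \<in> borel_measurable borel"
  shows "(\<integral>\<^sup>+x. f (x + t) \<partial>lborel) = (\<integral>\<^sup>+x. f x \<partial>lborel)"
    "(\<integral>\<^sup>+x. f (x - t) \<partial>lborel) = (\<integral>\<^sup>+x. f x \<partial>lborel)"
proof -
  have *: "(\<integral>\<^sup>+x. f (x + t) \<partial>lborel) = (\<integral>\<^sup>+x. f x \<partial>lborel)" for t
    by (subst (2) lborel_distr_plus[symmetric, of t])
      (simp add: nn_integral_distr add.commute)
  show "(\<integral>\<^sup>+x. f (x + t) \<partial>lborel) = (\<integral>\<^sup>+x. f x \<partial>lborel)" by (rule *)
  show "(\<integral>\<^sup>+x. f (x - t) \<partial>lborel) = (\<integral>\<^sup>+x. f x \<partial>lborel)" using *[of "-t"] by simp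
qed

lemma local_maximal_shift:
  fixes u :: "'a::euclidean_space \<Rightarrow> ennreal"
  assumes [measurable]: "u \<in> borel_measurable borel"
  shows "local_maximal (\<lambda>y. u (y - z)) x = local_maximal u (x - z)"
proof -
  have "(\<integral>\<^sup>+y. u (y - z) * indicator (ball x r) y \<partial>lborel)
      = (\<integral>\<^sup>+y. u y * indicator (ball (x - z) r) y \<partial>lborel)" for r
  proof -
    have "indicator (ball x r) y = (indicator (ball (x - z) r) (y - z) :: ennreal)" for y
      by (auto simp: indicator_def dist_norm)
    then have "(\<integral>\<^sup>+y. u (y - z) * indicator (ball x r) y \<partial>lborel)
      = (\<integral>\<^sup>+y. u (y - z) * indicator (ball (x - z) r) (y - z) \<partial>lborel)" by simp
    also have "\<dots> = (\<integral>\<^sup>+y. u y * indicator (ball (x - z) r) y \<partial>lborel)"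
      by (rule nn_integral_lborel_shift(2))
        (intro borel_measurable_times_ennreal assms borel_measurable_indicator, simp)
    finally show ?thesis .
  qed
  moreover have "emeasure lborel (ball x r) = emeasure lborel (ball (x - z) r)" if "r \<in> {0<..1}" for r
    using that by (intro emeasure_lborel_ball_cong) auto
  ultimately show ?thesis
    unfolding local_maximal_def by (intro SUP_cong) auto
qed

text \<open>Subadditivity on the left, additivity over disjoint sets on the right. The weak-type
  bound needs this for two pairs: enlarged balls against balls under Lebesgue measure, and a
  multiple of Lebesgue measure against \<open>density lborel u\<close> on the same balls.\<close>

lemma emeasure_UN_countable_le:
  fixes F :: "'i \<Rightarrow> 'a set"
  assumes "countable I" "\<And>i. i \<in> I \<Longrightarrow> F i \<in> sets M" "\<And>i. i \<in> I \<Longrightarrow> G i \<in> sets N"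
    and disj: "disjoint_family_on G I"
    and le: "\<And>i. i \<in> I \<Longrightarrow> emeasure M (F i) \<le> c * emeasure N (G i)"
  shows "emeasure M (\<Union>i\<in>I. F i) \<le> c * emeasure N (\<Union>i\<in>I. G i)"
proof (cases "I = {}")
  case False
  have "emeasure M (\<Union>i\<in>I. F i) = (\<integral>\<^sup>+x. indicator (\<Union>i\<in>I. F i) x \<partial>M)"
    using assms by (intro nn_integral_indicator[symmetric] sets.countable_UN') auto
  \<comment> \<open>Sums over \<open>I\<close> are integrals over \<open>count_space I\<close>, so
    that no enumeration of the countable set has to be chosen.\<close>
  also have "\<dots> \<le> (\<integral>\<^sup>+x. (\<integral>\<^sup>+i. indicator (F i) x \<partial>count_space I) \<partial>M)"
  proof (rule nn_integral_mono)
    fix x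
    show "indicator (\<Union>i\<in>I. F i) x \<le> (\<integral>\<^sup>+i. (indicator (F i) x :: ennreal) \<partial>count_space I)"
    proof (cases "x \<in> (\<Union>i\<in>I. F i)")
      case True
      then obtain i where i: "i \<in> I" "x \<in> F i" by auto
      have "(1::ennreal) = indicator (F i) x" using i by simp
      also have "\<dots> \<le> (\<integral>\<^sup>+i. (indicator (F i) x :: ennreal) \<partial>count_space I)"
        using i by (intro nn_integral_ge_point)
      finally show ?thesis using True by simp
    qed simp
  qed
  also have "\<dots> = (\<integral>\<^sup>+i. (\<integral>\<^sup>+x. indicator (F i) x \<partial>M) \<partial>count_space I)"
    using assms(1,2) by (intro nn_integral_count_space_nn_integral) auto
  also have "\<dots> = (\<integral>\<^sup>+i. emeasure M (F i) \<partial>count_space I)"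
    using assms(2) by (intro nn_integral_cong) simp
  also have "\<dots> \<le> (\<integral>\<^sup>+i. c * emeasure N (G i) \<partial>count_space I)"
    using le by (intro nn_integral_mono) simp
  also have "\<dots> = c * emeasure N (\<Union>i\<in>I. G i)"
    using assms by (simp add: nn_integral_cmult emeasure_UN_countable)
  finally show ?thesis .
qed simp

text \<open>Vitali: disjoint balls are selected whose fivefold enlargements cover the level set, and
  on each selected ball the integral of \<open>u\<close> exceeds \<open>t\<close> times the volume.
  Enlarging by 5 costs the factor 5 to the dimension.\<close>

lemma local_maximal_weak_type:
  fixes u :: "'a::euclidean_space \<Rightarrow> ennreal"
  assumes u[measurable]: "u \<in> borel_measurable borel"
  shows "ennreal t * emeasure lborel {x. ennreal t < local_maximal u x}
    \<le> 5 ^ DIM('a) * (\<integral>\<^sup>+x. u x \<partial>lborel)"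
proof -
  let ?S = "{x. ennreal t < local_maximal u x}"
  have "\<forall>x\<in>?S. \<exists>r. 0 < r \<and> r \<le> 1 \<and>
      ennreal t * emeasure lborel (ball x r) < emeasure (density lborel u) (ball x r)"
    by (auto simp: local_maximal_less_iff)
  then obtain r where r: "\<And>x. x \<in> ?S \<Longrightarrow> 0 < r x \<and> r x \<le> 1 \<and>
      ennreal t * emeasure lborel (ball x (r x)) < emeasure (density lborel u) (ball x (r x))"
    by metis
  obtain C where C: "countable C" "C \<subseteq> ?S"
    "pairwise (\<lambda>i j. disjnt (ball i (r i)) (ball j (r j))) C"
    "?S \<subseteq> (\<Union>i\<in>C. ball i (5 * r i))"
    by (rule Vitali_covering_lemma_balls[where S="?S" and K="?S" and a="\<lambda>x. x" and r=r and B=1]) (use r in force)+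
  have "ennreal t * emeasure lborel ?S \<le> ennreal t * emeasure lborel (\<Union>i\<in>C. ball i (5 * r i))"
    using C by (intro mult_left_mono emeasure_mono) auto
  also have "\<dots> \<le> ennreal t * (5 ^ DIM('a) * emeasure lborel (\<Union>i\<in>C. ball i (r i)))"
  proof (intro mult_left_mono emeasure_UN_countable_le)
    show "disjoint_family_on (\<lambda>i. ball i (r i)) C"
      using C(3) by (auto simp: disjoint_family_on_def pairwise_def disjnt_def)
    fix i assume "i \<in> C"
    then have "0 < r i" using C r by auto
    then show "emeasure lborel (ball i (5 * r i)) \<le> 5 ^ DIM('a) * emeasure lborel (ball i (r i))"
      by (simp add: emeasure_ball power_mult_distrib ennreal_mult' ennreal_power[symmetric] mult_ac)
  qed (use C in auto)
  also have "\<dots> = 5 ^ DIM('a) * emeasure (density lborel (\<lambda>_. ennreal t)) (\<Union>i\<in>C. ball i (r i))"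
    using C(1) by (subst emeasure_density_const) (auto simp: mult_ac)
  also have "\<dots> \<le> 5 ^ DIM('a) * (1 * emeasure (density lborel u) (\<Union>i\<in>C. ball i (r i)))"
  proof (intro mult_left_mono emeasure_UN_countable_le)
    show "disjoint_family_on (\<lambda>i. ball i (r i)) C"
      using C(3) by (auto simp: disjoint_family_on_def pairwise_def disjnt_def)
    fix i assume "i \<in> C"
    then show "emeasure (density lborel (\<lambda>_. ennreal t)) (ball i (r i))
        \<le> 1 * emeasure (density lborel u) (ball i (r i))"
      using C r by (subst emeasure_density_const) (auto intro: less_imp_le)
  qed (use C in auto)
  also have "\<dots> \<le> 5 ^ DIM('a) * emeasure (density lborel u) (space lborel)"
    by (auto intro!: mult_left_mono emeasure_mono)
  also have "emeasure (density lborel u) (space lborel) = (\<integral>\<^sup>+x. u x \<partial>lborel)"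
    by (simp add: emeasure_density)
  finally show ?thesis .
qed

text \<open>The part of \<open>u\<close> not exceeding \<open>t\<close> contributes at most
  \<open>t\<close> to the maximal function, so reaching level \<open>2 * t\<close> forces the part
  above \<open>t\<close> to reach level \<open>t\<close> alone. This is the form of the weak bound
  that interpolation requires.\<close>

lemma local_maximal_weak_type_truncated:
  fixes u :: "'a::euclidean_space \<Rightarrow> ennreal"
  assumes u[measurable]: "u \<in> borel_measurable borel" and t: "0 \<le> t"
  shows "ennreal t * emeasure lborel {x. ennreal (2 * t) < local_maximal u x}
    \<le> 5 ^ DIM('a) * (\<integral>\<^sup>+x. u x * indicator {x. ennreal t < u x} x \<partial>lborel)"
proof -
  let ?v = "\<lambda>x. u x * indicator {x. ennreal t < u x} x"
  have "{x. ennreal (2 * t) < local_maximal u x} \<subseteq> {x. ennreal t < local_maximal ?v x}"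
  proof safe
    fix x assume gt: "ennreal (2 * t) < local_maximal u x"
    have "local_maximal u x \<le> local_maximal (\<lambda>y. ?v y + ennreal t) x"
      by (intro local_maximal_mono) (auto simp: indicator_def)
    also have "\<dots> \<le> local_maximal ?v x + local_maximal (\<lambda>y. ennreal t) x"
      by (rule local_maximal_add) measurable
    also have "\<dots> \<le> local_maximal ?v x + ennreal t"
      by (intro add_left_mono local_maximal_const)
    finally have le: "local_maximal u x \<le> local_maximal ?v x + ennreal t" .
    show "ennreal t < local_maximal ?v x"
    proof (rule ccontr)
      assume "\<not> ennreal t < local_maximal ?v x"
      then have "local_maximal ?v x + ennreal t \<le> ennreal t + ennreal t"
        by (intro add_right_mono) simp
      also have "\<dots> = ennreal (2 * t)" using t by (simp flip: ennreal_plus)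
      finally show False using gt le by simp
    qed
  qed
  then have "ennreal t * emeasure lborel {x. ennreal (2 * t) < local_maximal u x}
     \<le> ennreal t * emeasure lborel {x. ennreal t < local_maximal ?v x}"
    by (intro mult_left_mono emeasure_mono) auto
  also have "\<dots> \<le> 5 ^ DIM('a) * (\<integral>\<^sup>+x. ?v x \<partial>lborel)"
    by (rule local_maximal_weak_type) measurable
  finally show ?thesis .
qed

section \<open>The local maximal operator: strong type\<close>

text \<open>The \<open>p\<close>-th power on \<open>[0, \<infinity>]\<close>, written as its own layer-cake integral.\<close>

definition epow :: "real \<Rightarrow> ennreal \<Rightarrow> ennreal" where
  "epow p t = (\<integral>\<^sup>+s. ennreal (p * s powr (p - 1)) * indicator {s. 0 < s \<and> ennreal s < t} s \<partial>lborel)"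

lemma epow_mono: "t \<le> t' \<Longrightarrow> epow p t \<le> epow p t'"
  unfolding epow_def
  by (intro nn_integral_mono mult_left_mono) (auto simp: indicator_def)

text \<open>Needed also for the exponent p - 2, which is negative when p < 2 but still above -1. The
  endpoints are null, which reconciles the closed interval of the library integral with the strict
  inequalities of the layer-cake formula.\<close>

lemma nn_integral_powr_0_to:
  assumes "-1 < q" "0 \<le> a"
  shows "(\<integral>\<^sup>+s. ennreal (s powr q) * indicator {s. 0 < s \<and> s < a} s \<partial>lborel)
    = ennreal (a powr (q + 1) / (q + 1))"
proof -
  have "(\<integral>\<^sup>+s. ennreal (s powr q) * indicator {0..a} s \<partial>lborel) = ennreal (a powr (q + 1) / (q + 1))"
    using assms by (intro nn_integral_has_integral_lebesgue' has_integral_powr_from_0) auto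
  moreover have "(\<integral>\<^sup>+s. ennreal (s powr q) * indicator {0..a} s \<partial>lborel)
      = (\<integral>\<^sup>+s. ennreal (s powr q) * indicator {s. 0 < s \<and> s < a} s \<partial>lborel)"
  proof (rule nn_integral_cong_AE)
    show "AE s in lborel. ennreal (s powr q) * indicator {0..a} s
        = ennreal (s powr q) * indicator {s. 0 < s \<and> s < a} s"
      using AE_lborel_singleton[of 0] AE_lborel_singleton[of a]
      by eventually_elim (auto simp: indicator_def)
  qed
  ultimately show ?thesis by simp
qed

lemma epow_ennreal:
  assumes "0 < p" "0 \<le> a"
  shows "epow p (ennreal a) = ennreal (a powr p)"
proof -
  have "epow p (ennreal a)
      = (\<integral>\<^sup>+s. ennreal p * (ennreal (s powr (p - 1)) * indicator {s. 0 < s \<and> s < a} s) \<partial>lborel)"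
    unfolding epow_def using assms
    by (intro nn_integral_cong) (auto simp: indicator_def ennreal_mult ennreal_less_iff)
  also have "\<dots> = ennreal p * ennreal (a powr (p - 1 + 1) / (p - 1 + 1))"
    using assms nn_integral_powr_0_to[of "p - 1" a] by (subst nn_integral_cmult) auto
  also have "\<dots> = ennreal (a powr p)"
    using assms by (simp flip: ennreal_mult)
  finally show ?thesis .
qed

text \<open>A number lies below a supremum exactly when it lies below one of the members, so the
  layer of the supremum is the union of the layers, and its indicator is at most the sum of
  theirs.\<close>

lemma epow_SUP_le: "epow p (SUP i. t i) \<le> (\<Sum>i. epow p (t i))" for t :: "nat \<Rightarrow> ennreal"
proof -
  have "epow p (SUP i. t i)
    \<le> (\<integral>\<^sup>+s. (\<Sum>i. ennreal (p * s powr (p - 1)) * indicator {s. 0 < s \<and> ennreal s < t i} s) \<partial>lborel)"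
    unfolding epow_def
  proof (rule nn_integral_mono)
    fix s
    let ?c = "ennreal (p * s powr (p - 1))"
    show "?c * indicator {s. 0 < s \<and> ennreal s < (SUP i. t i)} s
      \<le> (\<Sum>i. ?c * indicator {s. 0 < s \<and> ennreal s < t i} s)"
    proof (cases "0 < s \<and> ennreal s < (SUP i. t i)")
      case True
      then obtain i where i: "ennreal s < t i" by (auto simp: less_SUP_iff)
      have "?c * indicator {s. 0 < s \<and> ennreal s < (SUP i. t i)} s
        = (\<Sum>i\<in>{i}. ?c * indicator {s. 0 < s \<and> ennreal s < t i} s)"
        using True i by simp
      also have "\<dots> \<le> (\<Sum>i. ?c * indicator {s. 0 < s \<and> ennreal s < t i} s)"
        by (rule sum_le_suminf) auto
      finally show ?thesis .
    qed simp
  qed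
  also have "\<dots> = (\<Sum>i. epow p (t i))"
    unfolding epow_def by (rule nn_integral_suminf) measurable
  finally show ?thesis .
qed

lemma borel_measurable_epow [measurable]:
  assumes [measurable]: "f \<in> borel_measurable M"
  shows "(\<lambda>x. epow p (f x)) \<in> borel_measurable M"
  unfolding epow_def by measurable

text \<open>The factor \<open>5 ^ d\<close> is the Vitali enlargement; the rest comes from
  integrating 2 p s^(p-2) over 0 < s < 2|v|, which gives (2^p p / (p - 1)) |v|^(p-1).\<close>

definition maximal_const :: "real \<Rightarrow> nat \<Rightarrow> real" where
  "maximal_const p d = 5 ^ d * (2 powr p * p / (p - 1))"

text \<open>Marcinkiewicz interpolation between the weak bound on integrable functions and the
  trivial bound on bounded ones: Tonelli exposes the level sets, each is estimated by the truncated
  weak bound, and Tonelli again leaves an elementary integral in \<open>s\<close> for every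
  point.\<close>

lemma local_maximal_strong_type:
  fixes v :: "'a::euclidean_space \<Rightarrow> real"
  assumes v[measurable]: "v \<in> borel_measurable borel" and p: "1 < p"
  shows "(\<integral>\<^sup>+x. epow p (local_maximal (\<lambda>y. ennreal \<bar>v y\<bar>) x) \<partial>lborel)
    \<le> ennreal (maximal_const p DIM('a)) * (\<integral>\<^sup>+x. ennreal (\<bar>v x\<bar> powr p) \<partial>lborel)"
proof -
  define u where "u = (\<lambda>y. ennreal \<bar>v y\<bar>)"
  have u[measurable]: "u \<in> borel_measurable borel" unfolding u_def by measurable
  have "(\<integral>\<^sup>+x. epow p (local_maximal u x) \<partial>lborel)
      = (\<integral>\<^sup>+s. (\<integral>\<^sup>+x. ennreal (p * s powr (p - 1)) *
          indicator {s. 0 < s \<and> ennreal s < local_maximal u x} s \<partial>lborel) \<partial>lborel)"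
    unfolding epow_def by (rule lborel_pair.Fubini') measurable
  also have "\<dots> \<le> (\<integral>\<^sup>+s. (\<integral>\<^sup>+x. 5 ^ DIM('a) * (u x * (ennreal (2 * p) * (ennreal (s powr (p - 2)) *
          indicator {s. 0 < s \<and> s < 2 * \<bar>v x\<bar>} s))) \<partial>lborel) \<partial>lborel)"
  proof (rule nn_integral_mono)
    fix s :: real
    show "(\<integral>\<^sup>+x. ennreal (p * s powr (p - 1)) *
          indicator {s. 0 < s \<and> ennreal s < local_maximal u x} s \<partial>lborel)
      \<le> (\<integral>\<^sup>+x. 5 ^ DIM('a) * (u x * (ennreal (2 * p) * (ennreal (s powr (p - 2)) *
          indicator {s. 0 < s \<and> s < 2 * \<bar>v x\<bar>} s))) \<partial>lborel)"
    proof (cases "0 < s")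
      case True
      \<comment> \<open>One factor s/2 is split off because it is the level at which the truncated
        weak bound is applied.\<close>
      have split: "ennreal (p * s powr (p - 1)) = ennreal (2 * p * s powr (p - 2)) * ennreal (s / 2)"
        using True p by (simp add: powr_diff power2_eq_square flip: ennreal_mult)
      have "(\<integral>\<^sup>+x. ennreal (p * s powr (p - 1)) *
          indicator {s. 0 < s \<and> ennreal s < local_maximal u x} s \<partial>lborel)
        = (\<integral>\<^sup>+x. ennreal (p * s powr (p - 1)) * indicator {x. ennreal s < local_maximal u x} x \<partial>lborel)"
        using True by (intro nn_integral_cong) (auto simp: indicator_def)
      also have "\<dots> = ennreal (p * s powr (p - 1)) * emeasure lborel {x. ennreal s < local_maximal u x}"
        by (rule nn_integral_cmult_indicator) measurable
      also have "\<dots> = ennreal (2 * p * s powr (p - 2)) *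
          (ennreal (s / 2) * emeasure lborel {x. ennreal (2 * (s / 2)) < local_maximal u x})"
        by (simp add: split mult.assoc)
      also have "\<dots> \<le> ennreal (2 * p * s powr (p - 2)) *
          (5 ^ DIM('a) * (\<integral>\<^sup>+x. u x * indicator {x. ennreal (s / 2) < u x} x \<partial>lborel))"
        using True by (intro mult_left_mono local_maximal_weak_type_truncated) auto
      also have "\<dots> = (\<integral>\<^sup>+x. ennreal (2 * p * s powr (p - 2)) * (5 ^ DIM('a) *
          (u x * indicator {x. ennreal (s / 2) < u x} x)) \<partial>lborel)"
        by (simp add: nn_integral_cmult)
      also have "\<dots> = (\<integral>\<^sup>+x. 5 ^ DIM('a) * (u x * (ennreal (2 * p) * (ennreal (s powr (p - 2)) *
          indicator {s. 0 < s \<and> s < 2 * \<bar>v x\<bar>} s))) \<partial>lborel)"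
        using True p
        by (intro nn_integral_cong) (auto simp: indicator_def ennreal_mult mult_ac u_def ennreal_less_iff)
      finally show ?thesis .
    qed simp
  qed
  also have "\<dots> = (\<integral>\<^sup>+x. (\<integral>\<^sup>+s. 5 ^ DIM('a) * (u x * (ennreal (2 * p) * (ennreal (s powr (p - 2)) *
          indicator {s. 0 < s \<and> s < 2 * \<bar>v x\<bar>} s))) \<partial>lborel) \<partial>lborel)"
    by (rule lborel_pair.Fubini'[symmetric]) measurable
  also have "\<dots> = (\<integral>\<^sup>+x. ennreal (maximal_const p DIM('a)) * ennreal (\<bar>v x\<bar> powr p) \<partial>lborel)"
  proof (rule nn_integral_cong)
    fix x :: 'a
    have "(\<integral>\<^sup>+s. 5 ^ DIM('a) * (u x * (ennreal (2 * p) * (ennreal (s powr (p - 2)) *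
          indicator {s. 0 < s \<and> s < 2 * \<bar>v x\<bar>} s))) \<partial>lborel)
      = 5 ^ DIM('a) * (u x * (ennreal (2 * p) * ennreal ((2 * \<bar>v x\<bar>) powr (p - 2 + 1) / (p - 2 + 1))))"
      using p nn_integral_powr_0_to[of "p - 2" "2 * \<bar>v x\<bar>"] by (simp add: nn_integral_cmult)
    also have "\<dots> = ennreal (5 ^ DIM('a) * (\<bar>v x\<bar> * (2 * p * ((2 * \<bar>v x\<bar>) powr (p - 1) / (p - 1)))))"
      using p ennreal_power[of 5 "DIM('a)"]
      by (simp add: u_def flip: ennreal_mult)
    also have "5 ^ DIM('a) * (\<bar>v x\<bar> * (2 * p * ((2 * \<bar>v x\<bar>) powr (p - 1) / (p - 1))))
      = maximal_const p DIM('a) * \<bar>v x\<bar> powr p"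
      by (cases "v x = 0") (simp_all add: maximal_const_def powr_mult powr_diff)
    finally show "(\<integral>\<^sup>+s. 5 ^ DIM('a) * (u x * (ennreal (2 * p) * (ennreal (s powr (p - 2)) *
          indicator {s. 0 < s \<and> s < 2 * \<bar>v x\<bar>} s))) \<partial>lborel)
      = ennreal (maximal_const p DIM('a)) * ennreal (\<bar>v x\<bar> powr p)"
      using p by (simp add: maximal_const_def flip: ennreal_mult)
  qed
  also have "\<dots> = ennreal (maximal_const p DIM('a)) * (\<integral>\<^sup>+x. ennreal (\<bar>v x\<bar> powr p) \<partial>lborel)"
    by (rule nn_integral_cmult) measurable
  finally show ?thesis unfolding u_def .
qed

section \<open>Density of continuous functions in \<open>L\<^sup>p\<close>\<close>

definition lp_pow :: "real \<Rightarrow> ('a::euclidean_space \<Rightarrow> real) \<Rightarrow> ennreal" where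
  "lp_pow p g = (\<integral>\<^sup>+x. ennreal (\<bar>g x\<bar> powr p) \<partial>lborel)"

text \<open>Stands in for Minkowski's inequality: the constant is crude, but later only finiteness
  and smallness of p-th powers matter, and no roots have to be taken.\<close>

lemma abs_add_powr_le:
  fixes a b p :: real
  assumes "0 < p"
  shows "\<bar>a + b\<bar> powr p \<le> 2 powr p * (\<bar>a\<bar> powr p + \<bar>b\<bar> powr p)"
proof -
  have "\<bar>a + b\<bar> powr p \<le> (2 * max \<bar>a\<bar> \<bar>b\<bar>) powr p"
    using assms by (intro powr_mono2) auto
  also have "\<dots> = 2 powr p * max \<bar>a\<bar> \<bar>b\<bar> powr p"
    by (simp add: powr_mult)
  also have "\<dots> \<le> 2 powr p * (\<bar>a\<bar> powr p + \<bar>b\<bar> powr p)"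
    by (intro mult_left_mono) (auto simp: max_def)
  finally show ?thesis .
qed

lemma lp_pow_add_le:
  assumes [measurable]: "f \<in> borel_measurable borel" "g \<in> borel_measurable borel" and "0 < p"
  shows "lp_pow p (\<lambda>x. f x + g x) \<le> ennreal (2 powr p) * (lp_pow p f + lp_pow p g)"
proof -
  have "lp_pow p (\<lambda>x. f x + g x)
      \<le> (\<integral>\<^sup>+x. ennreal (2 powr p) * (ennreal (\<bar>f x\<bar> powr p) + ennreal (\<bar>g x\<bar> powr p)) \<partial>lborel)"
    unfolding lp_pow_def using abs_add_powr_le[OF \<open>0 < p\<close>]
    by (intro nn_integral_mono) (simp flip: ennreal_plus ennreal_mult)
  also have "\<dots> = ennreal (2 powr p) * (lp_pow p f + lp_pow p g)"
    unfolding lp_pow_def by (simp add: nn_integral_cmult nn_integral_add)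
  finally show ?thesis .
qed

lemma lp_pow_minus_commute: "lp_pow p (\<lambda>x. f x - g x) = lp_pow p (\<lambda>x. g x - f x)"
  by (simp add: lp_pow_def abs_minus_commute)

lemma tendsto_0_ennrealI:
  fixes u :: "'b \<Rightarrow> ennreal"
  assumes "\<And>e. 0 < e \<Longrightarrow> eventually (\<lambda>k. u k \<le> ennreal e) F"
  shows "(u \<longlongrightarrow> 0) F"
proof (rule order_tendstoI)
  fix a :: ennreal assume "0 < a"
  then obtain b where b: "0 < b" "b < a" using dense by blast
  then obtain e where e: "b = ennreal e" "0 < e"
    by (cases b) (auto simp: top.not_eq_extremum)
  show "eventually (\<lambda>k. u k < a) F"
    using assms[OF e(2)] b e by (auto elim!: eventually_mono)
qed simp

lemma lp_pow_dominated_tendsto_0: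
  fixes f :: "nat \<Rightarrow> 'a::euclidean_space \<Rightarrow> real"
  assumes [measurable]: "\<And>k. f k \<in> borel_measurable borel" "g \<in> borel_measurable borel"
    and "0 < p" and le: "\<And>k x. \<bar>f k x\<bar> \<le> g x" and fin: "lp_pow p g < \<infinity>"
    and lim: "AE x in lborel. (\<lambda>k. f k x) \<longlonglongrightarrow> 0"
  shows "(\<lambda>k. lp_pow p (f k)) \<longlonglongrightarrow> 0"
proof -
  have "(\<lambda>k. (\<integral>\<^sup>+x. ennreal (\<bar>f k x\<bar> powr p) \<partial>lborel)) \<longlonglongrightarrow> (\<integral>\<^sup>+x. 0 \<partial>(lborel :: 'a measure))"
  proof (rule nn_integral_dominated_convergence[where w = "\<lambda>x. ennreal (\<bar>g x\<bar> powr p)"])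
    show "AE x in lborel. ennreal (\<bar>f k x\<bar> powr p) \<le> ennreal (\<bar>g x\<bar> powr p)" for k
      using order_trans[OF le abs_ge_self] \<open>0 < p\<close> by (intro AE_I2 ennreal_leI powr_mono2) auto
    show "AE x in lborel. (\<lambda>k. ennreal (\<bar>f k x\<bar> powr p)) \<longlonglongrightarrow> 0"
      using lim
    proof eventually_elim
      case (elim x)
      then have "(\<lambda>k. \<bar>f k x\<bar> powr p) \<longlonglongrightarrow> 0 powr p"
        using \<open>0 < p\<close> by (intro tendsto_powr2 tendsto_rabs_zero) auto
      then show ?case using \<open>0 < p\<close> tendsto_ennrealI by fastforce
    qed
  qed (use fin in \<open>auto simp: lp_pow_def\<close>)
  then show ?thesis by (simp add: lp_pow_def)
qed

lemma lp_pow_bounded_support_finite: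
  fixes g :: "'a::euclidean_space \<Rightarrow> real"
  assumes "0 < p" "\<And>x. \<bar>g x\<bar> \<le> B * indicator (cball 0 R) x"
  shows "lp_pow p g < \<infinity>"
proof -
  have "lp_pow p g \<le> (\<integral>\<^sup>+x. ennreal (B powr p) * indicator (cball 0 R) x \<partial>(lborel :: 'a measure))"
    unfolding lp_pow_def
  proof (rule nn_integral_mono)
    fix x :: 'a
    show "ennreal (\<bar>g x\<bar> powr p) \<le> ennreal (B powr p) * indicator (cball 0 R) x"
      using assms(2)[of x] \<open>0 < p\<close> by (auto simp: indicator_def intro!: ennreal_leI powr_mono2)
  qed
  also have "\<dots> = ennreal (B powr p) * emeasure lborel (cball (0::'a) R)"
    by (rule nn_integral_cmult_indicator) auto
  also have "\<dots> < \<infinity>"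
    using emeasure_bounded_finite[OF bounded_cball, of "0::'a" R] by (simp add: ennreal_mult_less_top)
  finally show ?thesis .
qed

text \<open>Two successive approximations, each by dominated convergence: \<open>f\<close> is cut
  off in height and support, and the cut-off function is then an a.e. limit of continuous functions
  that obey the same height bound and vanish outside a slightly larger ball.\<close>

lemma continuous_compact_support_dense_lp:
  fixes f :: "'a::euclidean_space \<Rightarrow> real"
  assumes f[measurable]: "f \<in> borel_measurable borel" and p: "0 < p"
    and fin: "lp_pow p f < \<infinity>" and e: "0 < e"
  obtains h R where "continuous_on UNIV h" "\<And>x. R \<le> norm x \<Longrightarrow> h x = 0"
    "lp_pow p (\<lambda>x. f x - h x) < ennreal e"
proof -
  define c where "c = e / (2 * 2 powr p)"
  have c: "0 < c" "2 powr p * (c + c) = e" using e by (auto simp: c_def)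
  define clip where "clip = (\<lambda>m t :: real. max (- m) (min m t))"
  have clip_meas[measurable]: "clip m \<in> borel_measurable borel" for m
    unfolding clip_def by measurable
  define F where "F = (\<lambda>m::nat. \<lambda>x. if norm x \<le> real m then clip (real m) (f x) else 0)"
  have F[measurable]: "F m \<in> borel_measurable borel" for m unfolding F_def by measurable
  have "(\<lambda>m. lp_pow p (\<lambda>x. f x - F m x)) \<longlonglongrightarrow> 0"
  proof (rule lp_pow_dominated_tendsto_0[where g = "\<lambda>x. \<bar>f x\<bar>"])
    show "\<bar>f x - F m x\<bar> \<le> \<bar>f x\<bar>" for m x
      unfolding F_def clip_def by auto
    show "AE x in lborel. (\<lambda>m. f x - F m x) \<longlonglongrightarrow> 0"
    proof (rule AE_I2)
      fix x
      obtain M :: nat where M: "norm x + \<bar>f x\<bar> \<le> real M" using real_arch_simple by blast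
      have "\<forall>m\<ge>M. f x - F m x = 0"
      proof (intro allI impI)
        fix m assume "M \<le> m"
        then have "norm x + \<bar>f x\<bar> \<le> real m" using M by linarith
        then have "norm x \<le> real m" "\<bar>f x\<bar> \<le> real m" by (auto intro: order_trans[rotated])
        then show "f x - F m x = 0" by (auto simp: F_def clip_def)
      qed
      then show "(\<lambda>m. f x - F m x) \<longlonglongrightarrow> 0"
        by (intro tendsto_eventually) (auto simp: eventually_sequentially)
    qed
    show "lp_pow p (\<lambda>x. \<bar>f x\<bar>) < \<infinity>" using fin by (simp add: lp_pow_def)
  qed (use p in measurable)
  then have "eventually (\<lambda>m. lp_pow p (\<lambda>x. f x - F m x) < ennreal c) sequentially"
    using c by (intro order_tendstoD(2)) auto
  then obtain m where m: "lp_pow p (\<lambda>x. f x - F m x) < ennreal c"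
    by (auto simp: eventually_sequentially)
  have "F m \<in> borel_measurable lebesgue" by (rule measurable_completion) simp
  then have "F m measurable_on UNIV"
    using lebesgue_measurable_imp_measurable_on[of "F m" UNIV] by simp
  \<comment> \<open>The definition of \<open>measurable_on\<close> supplies continuous functions
    converging off a negligible set. They come without any bound, hence the clipping and the cutoff
    applied to them next.\<close>
  then obtain N h where N: "negligible N" and h: "\<And>k. continuous_on UNIV (h k)"
    and lim: "\<And>x. x \<notin> N \<Longrightarrow> (\<lambda>k. h k x) \<longlonglongrightarrow> F m x"
    unfolding measurable_on_def by auto
  \<comment> \<open>\<open>\<eta>\<close> is 1 on the ball of radius \<open>real m\<close>, where
    \<open>F m\<close> lives, and 0 beyond radius \<open>real m + 1\<close>; multiplying by it
    leaves the limit \<open>F m\<close> unchanged.\<close>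
  define \<eta> where "\<eta> = (\<lambda>x::'a. max 0 (min 1 (real m + 1 - norm x)))"
  define G where "G = (\<lambda>k x. clip (real m) (h k x) * \<eta> x)"
  have contG: "continuous_on UNIV (G k)" for k
    unfolding G_def \<eta>_def clip_def by (intro continuous_intros h)
  have G[measurable]: "G k \<in> borel_measurable borel" for k
    using contG by (rule borel_measurable_continuous_onI)
  have "(\<lambda>k. lp_pow p (\<lambda>x. F m x - G k x)) \<longlonglongrightarrow> 0"
  proof (rule lp_pow_dominated_tendsto_0[where g = "\<lambda>x. 2 * real m * indicator (cball 0 (real m + 1)) x"])
    show "\<bar>F m x - G k x\<bar> \<le> 2 * real m * indicator (cball 0 (real m + 1)) x" for k x
    proof -
      have "\<bar>F m x\<bar> \<le> real m * indicator (cball 0 (real m + 1)) x"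
        by (auto simp: F_def clip_def indicator_def)
      moreover have "\<bar>G k x\<bar> \<le> real m * indicator (cball 0 (real m + 1)) x"
      proof (cases "norm x \<le> real m + 1")
        case True
        have "\<bar>G k x\<bar> \<le> real m * 1"
          unfolding G_def abs_mult by (intro mult_mono) (auto simp: clip_def \<eta>_def)
        then show ?thesis using True by simp
      next
        case False
        then show ?thesis by (simp add: G_def \<eta>_def)
      qed
      ultimately show ?thesis by (auto intro: order_trans[OF abs_triangle_ineq4])
    qed
    show "lp_pow p (\<lambda>x::'a. 2 * real m * indicator (cball 0 (real m + 1)) x) < \<infinity>"
      using p by (rule lp_pow_bounded_support_finite[where B = "2 * real m"]) auto
    have "AE x in lebesgue. x \<notin> N" using N
      by (auto simp: negligible_iff_null_sets intro: AE_not_in)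
    then have "AE x in lborel. x \<notin> N" by (simp add: AE_completion_iff)
    then show "AE x in lborel. (\<lambda>k. F m x - G k x) \<longlonglongrightarrow> 0"
    proof eventually_elim
      case (elim x)
      have "(\<lambda>k. F m x - G k x) \<longlonglongrightarrow> F m x - clip (real m) (F m x) * \<eta> x"
        unfolding G_def clip_def by (intro tendsto_intros lim elim)
      also have "clip (real m) (F m x) * \<eta> x = F m x"
        by (auto simp: F_def clip_def \<eta>_def)
      finally show ?case by simp
    qed
  qed (use p in \<open>auto intro!: borel_measurable_times borel_measurable_indicator\<close>)
  then have "eventually (\<lambda>k. lp_pow p (\<lambda>x. F m x - G k x) < ennreal c) sequentially"
    using c by (intro order_tendstoD(2)) auto
  then obtain k where k: "lp_pow p (\<lambda>x. F m x - G k x) < ennreal c"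
    by (auto simp: eventually_sequentially)
  show ?thesis
  proof (rule that)
    show "continuous_on UNIV (G k)" by (rule contG)
    show "G k x = 0" if "real m + 1 \<le> norm x" for x using that by (simp add: G_def \<eta>_def)
    have "lp_pow p (\<lambda>x. f x - G k x) = lp_pow p (\<lambda>x. (f x - F m x) + (F m x - G k x))"
      by simp
    also have "\<dots> \<le> ennreal (2 powr p) * (lp_pow p (\<lambda>x. f x - F m x) + lp_pow p (\<lambda>x. F m x - G k x))"
      using p by (intro lp_pow_add_le) measurable
    also have "\<dots> < ennreal (2 powr p) * (ennreal c + ennreal c)"
      using m k by (intro ennreal_mult_strict_left_mono add_strict_mono) auto
    also have "\<dots> = ennreal e"
      using c by (simp flip: ennreal_plus ennreal_mult)
    finally show "lp_pow p (\<lambda>x. f x - G k x) < ennreal e" .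
  qed
qed

section \<open>Ball averages\<close>

definition ball_avg :: "real \<Rightarrow> ('a::euclidean_space \<Rightarrow> real) \<Rightarrow> 'a \<Rightarrow> real" where
  "ball_avg r g x = (\<integral>y. indicator (ball x r) y * g y \<partial>lborel) / measure lborel (ball x r)"

text \<open>A Bochner integral that does not exist has the value 0, so linearity of
  \<open>ball_avg\<close> is available only under this condition.\<close>

definition ball_integrable :: "('a::euclidean_space \<Rightarrow> real) \<Rightarrow> bool" where
  "ball_integrable g \<longleftrightarrow> (\<forall>x r. integrable lborel (\<lambda>y. indicator (ball x r) y * g y))"

lemma ball_integrableD: "ball_integrable g \<Longrightarrow> integrable lborel (\<lambda>y. indicator (ball x r) y * g y)"
  by (simp add: ball_integrable_def)

lemma measure_lborel_ball_pos: "0 < r \<Longrightarrow> 0 < measure lborel (ball x r :: 'a::euclidean_space set)"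
  by (simp add: content_ball)

lemma integrable_indicator_ball: "integrable lborel (indicator (ball (x::'a::euclidean_space) r) :: 'a \<Rightarrow> real)"
  by (intro integrable_real_indicator) (use emeasure_lborel_ball_finite[of x r] in auto)

lemma ball_integrable_continuous:
  fixes g :: "'a::euclidean_space \<Rightarrow> real"
  assumes g: "continuous_on UNIV g"
  shows "ball_integrable g"
  unfolding ball_integrable_def
proof (intro allI)
  fix x :: 'a and r
  have "integrable lborel (\<lambda>y. indicator (cball x r) y *\<^sub>R g y)"
    by (rule borel_integrable_compact) (auto intro: continuous_on_subset[OF g])
  then have "integrable lborel (\<lambda>y. indicator (ball x r) y *\<^sub>R (indicator (cball x r) y *\<^sub>R g y))"
    by (rule integrable_mult_indicator[rotated]) auto
  also have "(\<lambda>y. indicator (ball x r) y *\<^sub>R (indicator (cball x r) y *\<^sub>R g y))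
      = (\<lambda>y. indicator (ball x r) y * g y)"
    by (auto simp: indicator_def)
  finally show "integrable lborel (\<lambda>y. indicator (ball x r) y * g y)" .
qed

text \<open>Pointwise |g| \<le> 1 + |g|^p, and the constant 1 is integrable over a ball; this takes
  the place of Hoelder's inequality.\<close>

lemma ball_integrable_lp:
  fixes g :: "'a::euclidean_space \<Rightarrow> real"
  assumes g[measurable]: "g \<in> borel_measurable borel" and p: "1 \<le> p" and fin: "lp_pow p g < \<infinity>"
  shows "ball_integrable g"
  unfolding ball_integrable_def
proof (intro allI)
  fix x :: 'a and r
  have "integrable lborel (\<lambda>y. \<bar>g y\<bar> powr p)"
    using fin by (intro integrableI_bounded) (auto simp: lp_pow_def)
  then have "integrable lborel (\<lambda>y. indicator (ball x r) y + \<bar>g y\<bar> powr p)"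
    by (intro Bochner_Integration.integrable_add integrable_indicator_ball)
  then show "integrable lborel (\<lambda>y. indicator (ball x r) y * g y)"
  proof (rule Bochner_Integration.integrable_bound)
    show "AE y in lborel. norm (indicator (ball x r) y * g y) \<le> norm (indicator (ball x r) y + \<bar>g y\<bar> powr p)"
    proof (rule AE_I2)
      fix y
      have "\<bar>g y\<bar> \<le> 1 + \<bar>g y\<bar> powr p"
      proof (cases "\<bar>g y\<bar> \<le> 1")
        case False
        then have "\<bar>g y\<bar> powr 1 \<le> \<bar>g y\<bar> powr p" using p by (intro powr_mono) auto
        then show ?thesis by simp
      qed (simp add: add_increasing2)
      then show "norm (indicator (ball x r) y * g y) \<le> norm (indicator (ball x r) y + \<bar>g y\<bar> powr p)"
        by (auto simp: indicator_def)
    qed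
  qed (auto intro!: borel_measurable_times borel_measurable_indicator)
qed

lemma ball_avg_diff:
  assumes "ball_integrable f" "ball_integrable g"
  shows "ball_avg r (\<lambda>x. f x - g x) x = ball_avg r f x - ball_avg r g x"
  using assms[THEN ball_integrableD, of x r]
  by (simp add: ball_avg_def right_diff_distrib diff_divide_distrib)

lemma ball_avg_shift:
  fixes g :: "'a::euclidean_space \<Rightarrow> real"
  assumes [measurable]: "g \<in> borel_measurable borel" and "0 \<le> r"
  shows "ball_avg r (\<lambda>y. g (y - z)) x = ball_avg r g (x - z)"
proof -
  have "(\<integral>y. indicator (ball x r) y * g (y - z) \<partial>lborel)
      = (\<integral>y. indicator (ball x r) (z + y) * g ((z + y) - z) \<partial>lborel)"
    by (subst lborel_distr_plus[symmetric, of z], subst integral_distr)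
      (auto intro!: borel_measurable_times borel_measurable_indicator)
  also have "\<dots> = (\<integral>y. indicator (ball (x - z) r) y * g y \<partial>lborel)"
    by (intro Bochner_Integration.integral_cong) (auto simp: indicator_def dist_norm algebra_simps)
  finally show ?thesis using \<open>0 \<le> r\<close> by (simp add: ball_avg_def content_ball)
qed

text \<open>Serves three purposes: \<open>c\<close> the value at the centre gives convergence for
  continuous functions, \<open>c = 0\<close> a uniform bound, and \<open>c = 0\<close> with
  \<open>e = 0\<close> the vanishing of averages away from the support.\<close>

lemma ball_avg_dist_le:
  assumes g: "ball_integrable g" and r: "0 < r" and le: "\<And>y. y \<in> ball x r \<Longrightarrow> \<bar>g y - c\<bar> \<le> e"
  shows "\<bar>ball_avg r g x - c\<bar> \<le> e"
proof -
  let ?V = "measure lborel (ball x r)"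
  have V: "0 < ?V" using r by (rule measure_lborel_ball_pos)
  have int: "integrable lborel (\<lambda>y. indicator (ball x r) y * (g y - c))"
    using ball_integrableD[OF g, of x r] integrable_indicator_ball[of x r]
    by (simp add: right_diff_distrib)
  have "(\<integral>y. indicator (ball x r) y * (g y - c) \<partial>lborel)
     = (\<integral>y. indicator (ball x r) y * g y - indicator (ball x r) y * c \<partial>lborel)"
    by (simp add: right_diff_distrib)
  also have "\<dots> = (\<integral>y. indicator (ball x r) y * g y \<partial>lborel) - (\<integral>y. indicator (ball x r) y * c \<partial>lborel)"
    using ball_integrableD[OF g, of x r] integrable_indicator_ball[of x r]
    by (intro Bochner_Integration.integral_diff) auto
  also have "\<dots> = (\<integral>y. indicator (ball x r) y * g y \<partial>lborel) - c * ?V"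
    by simp
  finally have "ball_avg r g x - c = (\<integral>y. indicator (ball x r) y * (g y - c) \<partial>lborel) / ?V"
    using V by (simp add: ball_avg_def field_simps)
  also have "\<bar>\<dots>\<bar> \<le> (\<integral>y. indicator (ball x r) y * e \<partial>lborel) / ?V"
  proof -
    have "\<bar>\<integral>y. indicator (ball x r) y * (g y - c) \<partial>lborel\<bar>
      \<le> (\<integral>y. \<bar>indicator (ball x r) y * (g y - c)\<bar> \<partial>lborel)"
      by (rule integral_abs_bound)
    also have "\<dots> \<le> (\<integral>y. indicator (ball x r) y * e \<partial>lborel)"
    proof (rule integral_mono)
      show "integrable lborel (\<lambda>y. \<bar>indicator (ball x r) y * (g y - c)\<bar>)"
        using int by (rule integrable_abs)
      show "integrable lborel (\<lambda>y. indicator (ball x r) y * e)"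
        using integrable_indicator_ball[of x r] by simp
    qed (use le in \<open>auto simp: indicator_def\<close>)
    finally have "\<bar>\<integral>y. indicator (ball x r) y * (g y - c) \<partial>lborel\<bar> / ?V
        \<le> (\<integral>y. indicator (ball x r) y * e \<partial>lborel) / ?V"
      by (rule divide_right_mono) simp
    then show ?thesis by (simp only: abs_divide abs_of_pos[OF V])
  qed
  also have "\<dots> = e" using V by simp
  finally show ?thesis .
qed

lemma ball_avg_tendsto:
  fixes g :: "'a::euclidean_space \<Rightarrow> real"
  assumes g: "continuous_on UNIV g"
  shows "((\<lambda>r. ball_avg r g x) \<longlongrightarrow> g x) (at_right 0)"
proof (rule tendstoI)
  fix e :: real assume e: "0 < e"
  obtain d where d: "0 < d" "\<And>y. dist y x < d \<Longrightarrow> dist (g y) (g x) < e / 2"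
    using g e unfolding continuous_on_iff by (metis UNIV_I half_gt_zero)
  have "eventually (\<lambda>r. r \<in> {0<..<d}) (at_right 0)"
    using d by (intro eventually_at_right_real)
  then show "eventually (\<lambda>r. dist (ball_avg r g x) (g x) < e) (at_right 0)"
  proof eventually_elim
    case (elim r)
    have "\<bar>ball_avg r g x - g x\<bar> \<le> e / 2"
    proof (rule ball_avg_dist_le[OF ball_integrable_continuous[OF g]])
      show "0 < r" using elim by simp
      fix y assume "y \<in> ball x r"
      then have "dist y x < d" using elim by (simp add: dist_commute)
      then show "\<bar>g y - g x\<bar> \<le> e / 2" using d(2) by (simp add: dist_real_def less_imp_le)
    qed
    then show ?case using e by (simp add: dist_real_def)
  qed
qed

lemma borel_measurable_ball_avg [measurable]:
  fixes g :: "'a::euclidean_space \<Rightarrow> real"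
  assumes [measurable]: "g \<in> borel_measurable borel"
  shows "ball_avg r g \<in> borel_measurable borel"
proof -
  have "measure lborel (ball x r) = measure lborel (ball (0::'a) r)" for x :: 'a
    by (cases "0 \<le> r") (auto simp: content_ball ball_empty)
  moreover have "indicator (ball x r) y = (if dist x y < r then 1 else 0 :: real)" for x y :: 'a
    by (simp add: indicator_def)
  ultimately have "ball_avg r g = (\<lambda>x. (\<integral>y. (if dist x y < r then 1 else 0) * g y \<partial>lborel)
      / measure lborel (ball (0::'a) r))"
    by (simp add: ball_avg_def fun_eq_iff)
  also have "\<dots> \<in> borel_measurable borel"
    by measurable
  finally show ?thesis .
qed

text \<open>When the centres converge, the indicators of the balls converge off the limiting sphere,
  which is a null set; all the moving balls stay inside one larger ball, where \<open>g\<close> is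
  integrable.\<close>

lemma continuous_on_ball_avg:
  fixes g :: "'a::euclidean_space \<Rightarrow> real"
  assumes [measurable]: "g \<in> borel_measurable borel" and g: "ball_integrable g" and r: "0 < r"
  shows "continuous_on UNIV (ball_avg r g)"
proof -
  have "isCont (ball_avg r g) x" for x
    unfolding continuous_at_sequentially
  proof (intro allI impI)
    fix u assume u: "u \<longlonglongrightarrow> x"
    obtain R where R: "\<And>n. dist x (u n) \<le> R"
      using convergent_imp_bounded[OF u] bounded_any_center[of "range u" x] by auto
    have "(\<lambda>n. \<integral>y. indicator (ball (u n) r) y * g y \<partial>lborel)
       \<longlonglongrightarrow> (\<integral>y. indicator (ball x r) y * g y \<partial>lborel)"
    proof (rule integral_dominated_convergence)
      show "integrable lborel (\<lambda>y. norm (indicator (ball x (R + r)) y * g y))"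
        using ball_integrableD[OF g] by (rule integrable_norm)
      show "AE y in lborel. norm (indicator (ball (u n) r) y * g y)
          \<le> norm (indicator (ball x (R + r)) y * g y)" for n
      proof (rule AE_I2)
        fix y
        have "y \<in> ball x (R + r)" if "y \<in> ball (u n) r"
          using that R[of n] dist_triangle[of x y "u n"] by auto
        then show "norm (indicator (ball (u n) r) y * g y) \<le> norm (indicator (ball x (R + r)) y * g y)"
          by (auto simp: indicator_def)
      qed
      have "AE y in lebesgue. y \<notin> sphere x r"
        using negligible_sphere[of x r] AE_not_in unfolding negligible_iff_null_sets by blast
      then have "AE y in lborel. y \<notin> sphere x r" by (simp add: AE_completion_iff)
      then show "AE y in lborel. (\<lambda>n. indicator (ball (u n) r) y * g y)
          \<longlonglongrightarrow> indicator (ball x r) y * g y"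
      proof eventually_elim
        case (elim y)
        have lim: "(\<lambda>n. dist (u n) y) \<longlonglongrightarrow> dist x y" by (intro tendsto_intros u)
        have "eventually (\<lambda>n. indicator (ball (u n) r) y = (indicator (ball x r) y :: real)) sequentially"
        proof (cases "dist x y < r")
          case True
          from order_tendstoD(2)[OF lim True] show ?thesis
            by eventually_elim (use True in auto)
        next
          case False
          then have "r < dist x y" using elim by auto
          from order_tendstoD(1)[OF lim this] show ?thesis
            by eventually_elim (use False in auto)
        qed
        then show ?case
          by (intro tendsto_eventually) (auto elim: eventually_mono)
      qed
    qed (auto intro!: borel_measurable_times borel_measurable_indicator)
    then have "(\<lambda>n. (\<integral>y. indicator (ball (u n) r) y * g y \<partial>lborel) / measure lborel (ball x r))
       \<longlonglongrightarrow> (\<integral>y. indicator (ball x r) y * g y \<partial>lborel) / measure lborel (ball x r)"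
      using measure_lborel_ball_pos[OF r, of x] by (intro tendsto_intros) auto
    then show "(ball_avg r g \<circ> u) \<longlonglongrightarrow> ball_avg r g x"
      using r by (simp add: ball_avg_def content_ball comp_def)
  qed
  then show ?thesis by (simp add: continuous_on_eq_continuous_at)
qed

lemma abs_ball_avg_le_local_maximal:
  fixes g :: "'a::euclidean_space \<Rightarrow> real"
  assumes r: "0 < r" "r \<le> 1"
  shows "ennreal \<bar>ball_avg r g x\<bar> \<le> local_maximal (\<lambda>y. ennreal \<bar>g y\<bar>) x"
proof (cases "integrable lborel (\<lambda>y. indicator (ball x r) y * g y)")
  case True
  have "ennreal \<bar>\<integral>y. indicator (ball x r) y * g y \<partial>lborel\<bar>
      \<le> (\<integral>\<^sup>+y. ennreal (norm (indicator (ball x r) y * g y)) \<partial>lborel)"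
    using integral_norm_bound_ennreal[OF True] by simp
  also have "\<dots> = (\<integral>\<^sup>+y. ennreal \<bar>g y\<bar> * indicator (ball x r) y \<partial>lborel)"
    by (intro nn_integral_cong) (auto simp: indicator_def)
  finally have "ennreal \<bar>\<integral>y. indicator (ball x r) y * g y \<partial>lborel\<bar> / emeasure lborel (ball x r)
    \<le> (\<integral>\<^sup>+y. ennreal \<bar>g y\<bar> * indicator (ball x r) y \<partial>lborel) / emeasure lborel (ball x r)"
    by (rule divide_right_mono_ennreal)
  also have "\<dots> \<le> local_maximal (\<lambda>y. ennreal \<bar>g y\<bar>) x"
    unfolding local_maximal_def using r by (intro SUP_upper) auto
  also have "emeasure lborel (ball x r) = ennreal (measure lborel (ball x r))"
    using emeasure_lborel_ball_finite[of x r] by (intro emeasure_eq_ennreal_measure) auto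
  finally show ?thesis
    using measure_lborel_ball_pos[OF r(1), of x] by (simp add: ball_avg_def divide_ennreal)
next
  \<comment> \<open>Here the average is 0 by the convention for non-integrable functions, and the
    bound is trivial.\<close>
  case False
  then show ?thesis by (simp add: ball_avg_def not_integrable_integral_eq)
qed

lemma lp_pow_ball_avg_le:
  fixes g :: "'a::euclidean_space \<Rightarrow> real"
  assumes g: "g \<in> borel_measurable borel" and p: "1 < p" and r: "0 < r" "r \<le> 1"
  shows "lp_pow p (ball_avg r g) \<le> ennreal (maximal_const p DIM('a)) * lp_pow p g"
proof -
  have "lp_pow p (ball_avg r g) = (\<integral>\<^sup>+x. epow p (ennreal \<bar>ball_avg r g x\<bar>) \<partial>lborel)"
    using p by (simp add: lp_pow_def epow_ennreal)
  also have "\<dots> \<le> (\<integral>\<^sup>+x. epow p (local_maximal (\<lambda>y. ennreal \<bar>g y\<bar>) x) \<partial>lborel)"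
    by (intro nn_integral_mono epow_mono abs_ball_avg_le_local_maximal r)
  also have "\<dots> \<le> ennreal (maximal_const p DIM('a)) * lp_pow p g"
    unfolding lp_pow_def using g p by (rule local_maximal_strong_type)
  finally show ?thesis .
qed

lemma maximal_const_nonneg: "1 < p \<Longrightarrow> 0 \<le> maximal_const p d"
  by (simp add: maximal_const_def)

lemma inverse_Suc_at_right_0: "filterlim (\<lambda>k. 1 / real (Suc k)) (at_right 0) sequentially"
  using LIMSEQ_inverse_real_of_nat by (simp add: filterlim_at inverse_eq_divide)

text \<open>Averages over radii at most 1 keep the sup bound of \<open>h\<close> and enlarge the
  support by at most 1, so one bounded function of bounded support dominates all the
  differences.\<close>

lemma ball_avg_lp_tendsto_compact_support:
  fixes h :: "'a::euclidean_space \<Rightarrow> real"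
  assumes h: "continuous_on UNIV h" and supp: "\<And>x. R \<le> norm x \<Longrightarrow> h x = 0" and p: "0 < p"
  shows "(\<lambda>k. lp_pow p (\<lambda>x. h x - ball_avg (1 / real (Suc k)) h x)) \<longlonglongrightarrow> 0"
proof -
  have int: "ball_integrable h" using h by (rule ball_integrable_continuous)
  have [measurable]: "h \<in> borel_measurable borel" using h by (rule borel_measurable_continuous_onI)
  have "bounded (h ` cball 0 R)"
    using compact_continuous_image[OF continuous_on_subset[OF h] compact_cball[of 0 R]]
    by (auto intro: compact_imp_bounded)
  then obtain B where "0 < B" "\<forall>y\<in>h ` cball 0 R. norm y \<le> B"
    unfolding bounded_pos by blast
  then have B: "\<And>x. x \<in> cball 0 R \<Longrightarrow> \<bar>h x\<bar> \<le> B" "0 < B" by auto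
  have hB: "\<bar>h x\<bar> \<le> B" for x
    using B supp[of x] by (cases "norm x \<le> R") auto
  show ?thesis
  proof (rule lp_pow_dominated_tendsto_0[where g = "\<lambda>x. 2 * B * indicator (cball 0 (R + 1)) x"])
    show "\<bar>h x - ball_avg (1 / real (Suc k)) h x\<bar> \<le> 2 * B * indicator (cball 0 (R + 1)) x" for k x
    proof (cases "norm x \<le> R + 1")
      case True
      have "\<bar>ball_avg (1 / real (Suc k)) h x - 0\<bar> \<le> B"
        by (rule ball_avg_dist_le[OF int]) (use hB in auto)
      then show ?thesis using True hB[of x] by auto
    next
      case False
      have "\<bar>ball_avg (1 / real (Suc k)) h x - 0\<bar> \<le> 0"
      proof (rule ball_avg_dist_le[OF int])
        fix y assume "y \<in> ball x (1 / real (Suc k))"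
        moreover have "1 / real (Suc k) \<le> 1" by simp
        ultimately have "dist x y < 1" by (simp only: mem_ball)
        then have "R \<le> norm y" using False norm_triangle_ineq2[of x y] by (simp add: dist_norm)
        then show "\<bar>h y - 0\<bar> \<le> 0" using supp by simp
      qed simp
      then show ?thesis using False supp[of x] by auto
    qed
    show "lp_pow p (\<lambda>x::'a. 2 * B * indicator (cball 0 (R + 1)) x) < \<infinity>"
      using p B by (intro lp_pow_bounded_support_finite[where B = "2 * B"]) auto
    show "AE x in lborel. (\<lambda>k. h x - ball_avg (1 / real (Suc k)) h x) \<longlonglongrightarrow> 0"
    proof (rule AE_I2)
      fix x
      have "(\<lambda>k. h x - ball_avg (1 / real (Suc k)) h x) \<longlonglongrightarrow> h x - h x"
        by (intro tendsto_diff tendsto_const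
            filterlim_compose[OF ball_avg_tendsto[OF h] inverse_Suc_at_right_0])
      then show "(\<lambda>k. h x - ball_avg (1 / real (Suc k)) h x) \<longlonglongrightarrow> 0" by simp
    qed
  qed (use p in \<open>auto intro!: borel_measurable_times borel_measurable_indicator\<close>)
qed

text \<open>Density argument: \<open>g\<close> is replaced by a continuous \<open>h\<close> of
  compact support, and the averages of \<open>h - g\<close> are controlled uniformly in the radius
  by the maximal bound.\<close>

lemma ball_avg_lp_tendsto:
  fixes g :: "'a::euclidean_space \<Rightarrow> real"
  assumes g[measurable]: "g \<in> borel_measurable borel" and p: "1 < p" and fin: "lp_pow p g < \<infinity>"
  shows "(\<lambda>k. lp_pow p (\<lambda>x. g x - ball_avg (1 / real (Suc k)) g x)) \<longlonglongrightarrow> 0"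
proof (rule tendsto_0_ennrealI)
  fix e :: real assume e: "0 < e"
  let ?r = "\<lambda>k. 1 / real (Suc k)"
  define C where "C = maximal_const p DIM('a)"
  define T where "T = (2::real) powr p"
  \<comment> \<open>Chosen so that two nested uses of the triangle inequality, each costing
    \<open>T\<close>, on three terms of sizes \<open>c\<close>, \<open>c\<close> and
    \<open>C * c\<close>, add up to exactly \<open>e\<close>.\<close>
  define c where "c = e / (T * (1 + T * (1 + C)))"
  have C: "0 \<le> C" using p by (simp add: C_def maximal_const_nonneg)
  have T: "0 < T" by (simp add: T_def)
  have pos: "0 < T * (1 + T * (1 + C))" using C T by (intro mult_pos_pos add_pos_nonneg) auto
  have c: "0 < c" using e pos by (simp add: c_def)
  have "c * (T * (1 + T * (1 + C))) = e" using pos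
    by (intro nonzero_eq_divide_eq[THEN iffD1, OF _ c_def]) linarith
  then have ceq: "T * (c + T * (c + C * c)) = e" by (simp add: algebra_simps)
  obtain h R where h: "continuous_on UNIV h" "\<And>x. R \<le> norm x \<Longrightarrow> h x = 0"
    and close: "lp_pow p (\<lambda>x. g x - h x) < ennreal c"
    using continuous_compact_support_dense_lp[OF g _ fin c] p by auto
  have [measurable]: "h \<in> borel_measurable borel" using h(1) by (rule borel_measurable_continuous_onI)
  have int: "ball_integrable h" "ball_integrable g"
    using h(1) p ball_integrable_lp[OF g _ fin] by (auto intro: ball_integrable_continuous)
  have "(\<lambda>k. lp_pow p (\<lambda>x. h x - ball_avg (?r k) h x)) \<longlonglongrightarrow> 0"
    using h p by (intro ball_avg_lp_tendsto_compact_support) auto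
  then have "eventually (\<lambda>k. lp_pow p (\<lambda>x. h x - ball_avg (?r k) h x) < ennreal c) sequentially"
    using c by (intro order_tendstoD(2)) auto
  then show "eventually (\<lambda>k. lp_pow p (\<lambda>x. g x - ball_avg (?r k) g x) \<le> ennreal e) sequentially"
  proof eventually_elim
    case (elim k)
    have r: "0 < ?r k" "?r k \<le> 1" by auto
    have "lp_pow p (\<lambda>x. ball_avg (?r k) h x - ball_avg (?r k) g x)
        = lp_pow p (ball_avg (?r k) (\<lambda>x. h x - g x))"
      using int by (simp add: lp_pow_def ball_avg_diff)
    also have "\<dots> \<le> ennreal C * lp_pow p (\<lambda>x. h x - g x)"
      unfolding C_def using p r by (intro lp_pow_ball_avg_le) auto
    also have "\<dots> \<le> ennreal C * ennreal c"
      using close by (intro mult_left_mono) (auto simp: lp_pow_minus_commute[of p h] intro: less_imp_le)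
    finally have 1: "lp_pow p (\<lambda>x. ball_avg (?r k) h x - ball_avg (?r k) g x) \<le> ennreal C * ennreal c" .
    have "lp_pow p (\<lambda>x. g x - ball_avg (?r k) g x)
        = lp_pow p (\<lambda>x. (g x - h x) + ((h x - ball_avg (?r k) h x) + (ball_avg (?r k) h x - ball_avg (?r k) g x)))"
      by (simp add: algebra_simps)
    also have "\<dots> \<le> ennreal T * (lp_pow p (\<lambda>x. g x - h x) +
        lp_pow p (\<lambda>x. (h x - ball_avg (?r k) h x) + (ball_avg (?r k) h x - ball_avg (?r k) g x)))"
      unfolding T_def using p by (intro lp_pow_add_le) auto
    also have "\<dots> \<le> ennreal T * (ennreal c + ennreal T * (lp_pow p (\<lambda>x. h x - ball_avg (?r k) h x)
        + lp_pow p (\<lambda>x. ball_avg (?r k) h x - ball_avg (?r k) g x)))"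
      unfolding T_def using p close by (intro mult_left_mono add_mono lp_pow_add_le) auto
    also have "\<dots> \<le> ennreal T * (ennreal c + ennreal T * (ennreal c + ennreal C * ennreal c))"
      using elim by (intro mult_left_mono add_mono 1) auto
    also have "\<dots> = ennreal e"
      using c C T by (simp add: ceq flip: ennreal_plus ennreal_mult)
    finally show ?case .
  qed
qed

section \<open>The energy of a translation-invariant kernel\<close>

text \<open>The Sobolev norm after the substitution z = x - y, with \<open>K z\<close> playing the
  role of the weight divided by |z|^(sp). For fixed \<open>z\<close> the inner term is an unweighted
  quantity.\<close>

definition energy :: "real \<Rightarrow> ('a::euclidean_space \<Rightarrow> real) \<Rightarrow> ('a \<Rightarrow> real) \<Rightarrow> ennreal" where
  "energy p K g =
     lp_pow p g + (\<integral>\<^sup>+z. ennreal (K z) * lp_pow p (\<lambda>x. g x - g (x - z)) \<partial>lborel)"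

lemma borel_measurable_lp_pow_difference [measurable]:
  fixes g :: "'a::euclidean_space \<Rightarrow> real"
  assumes [measurable]: "g \<in> borel_measurable borel"
  shows "(\<lambda>z. lp_pow p (\<lambda>x. g x - g (x - z))) \<in> borel_measurable borel"
  unfolding lp_pow_def by measurable

lemma lp_pow_shift:
  fixes g :: "'a::euclidean_space \<Rightarrow> real"
  assumes [measurable]: "g \<in> borel_measurable borel"
  shows "lp_pow p (\<lambda>x. g (x - z)) = lp_pow p g"
  unfolding lp_pow_def by (rule nn_integral_lborel_shift(2)) measurable

lemma lp_pow_cmult:
  assumes [measurable]: "g \<in> borel_measurable borel"
  shows "lp_pow p (\<lambda>x. c * g x) = ennreal (\<bar>c\<bar> powr p) * lp_pow p g"
  unfolding lp_pow_def by (simp add: abs_mult powr_mult ennreal_mult nn_integral_cmult)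

lemma lp_pow_uminus: "lp_pow p (\<lambda>x. - g x) = lp_pow p g"
  by (simp add: lp_pow_def)

lemma lp_pow_diff_le:
  assumes "f \<in> borel_measurable borel" "g \<in> borel_measurable borel" and "0 < p"
  shows "lp_pow p (\<lambda>x. f x - g x) \<le> ennreal (2 powr p) * (lp_pow p f + lp_pow p g)"
  using lp_pow_add_le[of f "\<lambda>x. - g x" p] assms by (simp add: lp_pow_uminus)

lemma energy_cmult:
  fixes g :: "'a::euclidean_space \<Rightarrow> real"
  assumes [measurable]: "g \<in> borel_measurable borel" "K \<in> borel_measurable borel"
  shows "energy p K (\<lambda>x. c * g x) = ennreal (\<bar>c\<bar> powr p) * energy p K g"
proof -
  have "lp_pow p (\<lambda>x. c * g x - c * g (x - z)) = ennreal (\<bar>c\<bar> powr p) * lp_pow p (\<lambda>x. g x - g (x - z))" for z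
    using lp_pow_cmult[of "\<lambda>x. g x - g (x - z)" p c] by (simp add: right_diff_distrib)
  then have "(\<integral>\<^sup>+z. ennreal (K z) * lp_pow p (\<lambda>x. c * g x - c * g (x - z)) \<partial>lborel)
      = (\<integral>\<^sup>+z. ennreal (\<bar>c\<bar> powr p) * (ennreal (K z) * lp_pow p (\<lambda>x. g x - g (x - z))) \<partial>lborel)"
    by (intro nn_integral_cong) (simp add: mult.left_commute)
  also have "\<dots> = ennreal (\<bar>c\<bar> powr p) * (\<integral>\<^sup>+z. ennreal (K z) * lp_pow p (\<lambda>x. g x - g (x - z)) \<partial>lborel)"
    by (rule nn_integral_cmult) measurable
  finally show ?thesis
    unfolding energy_def by (simp add: lp_pow_cmult distrib_left)
qed

lemma energy_ball_avg_tendsto: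
  fixes g :: "'a::euclidean_space \<Rightarrow> real"
  assumes g[measurable]: "g \<in> borel_measurable borel" and K[measurable]: "K \<in> borel_measurable borel"
    and p: "1 < p" and fin: "energy p K g < \<infinity>"
  shows "(\<lambda>k. energy p K (\<lambda>x. g x - ball_avg (1 / real (Suc k)) g x)) \<longlonglongrightarrow> 0"
proof -
  define A where "A = (\<lambda>k. ball_avg (1 / real (Suc k)) :: ('a \<Rightarrow> real) \<Rightarrow> 'a \<Rightarrow> real)"
  define C where "C = maximal_const p DIM('a)"
  define D where "D = (\<lambda>z x. g x - g (x - z))"
  have [measurable]: "A k f \<in> borel_measurable borel" if "f \<in> borel_measurable borel" for k f
    using that unfolding A_def by measurable
  have D[measurable]: "D z \<in> borel_measurable borel" for z unfolding D_def by measurable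
  have fin_g: "lp_pow p g < \<infinity>" using fin by (auto simp: energy_def)
  have fin_shift: "lp_pow p (\<lambda>x. g (x - z)) < \<infinity>" for z using fin_g by (simp add: lp_pow_shift)
  have int: "ball_integrable g" "ball_integrable (\<lambda>x. g (x - z))" for z
    using p fin_g fin_shift by (auto intro!: ball_integrable_lp[where p = p])
  have fin_D: "lp_pow p (D z) < \<infinity>" for z
  proof -
    have "lp_pow p (D z) \<le> ennreal (2 powr p) * (lp_pow p g + lp_pow p (\<lambda>x. g (x - z)))"
      unfolding D_def using p by (intro lp_pow_diff_le) auto
    also have "\<dots> < \<infinity>" using fin_g fin_shift by (simp add: ennreal_mult_less_top)
    finally show ?thesis .
  qed
  \<comment> \<open>Averaging is linear and commutes with translations, so the error of averaging,
    differenced by \<open>z\<close>, is the averaging error of the difference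
    \<open>D z\<close>.\<close>
  have AD: "(g x - A k g x) - (g (x - z) - A k g (x - z)) = D z x - A k (D z) x" for k x z
    using int by (simp add: A_def D_def ball_avg_diff ball_avg_shift)
  have "(\<lambda>k. \<integral>\<^sup>+z. ennreal (K z) * lp_pow p (\<lambda>x. D z x - A k (D z) x) \<partial>lborel) \<longlonglongrightarrow> (\<integral>\<^sup>+z. 0 \<partial>(lborel :: 'a measure))"
  proof (rule nn_integral_dominated_convergence)
    \<comment> \<open>The dominating function does not depend on \<open>k\<close> because the
      averaging bound is uniform over radii at most 1; its integral is a constant multiple of the
      seminorm part of the energy.\<close>
    let ?w = "\<lambda>z. ennreal (2 powr p) * ((1 + ennreal C) * (ennreal (K z) * lp_pow p (D z)))"
    show "(\<lambda>z. ennreal (K z) * lp_pow p (\<lambda>x. D z x - A k (D z) x)) \<in> borel_measurable lborel" for k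
      unfolding AD[symmetric] using borel_measurable_lp_pow_difference[of "\<lambda>x. g x - A k g x" p] by measurable
    show "?w \<in> borel_measurable lborel"
      unfolding D_def by measurable
    show "AE z in lborel. ennreal (K z) * lp_pow p (\<lambda>x. D z x - A k (D z) x) \<le> ?w z" for k
    proof (rule AE_I2)
      fix z
      have "lp_pow p (\<lambda>x. D z x - A k (D z) x) \<le> ennreal (2 powr p) * (lp_pow p (D z) + lp_pow p (A k (D z)))"
        using p by (intro lp_pow_diff_le) auto
      also have "\<dots> \<le> ennreal (2 powr p) * (lp_pow p (D z) + ennreal C * lp_pow p (D z))"
        unfolding C_def A_def using p by (intro mult_left_mono add_left_mono lp_pow_ball_avg_le) auto
      finally have "ennreal (K z) * lp_pow p (\<lambda>x. D z x - A k (D z) x)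
          \<le> ennreal (K z) * (ennreal (2 powr p) * (lp_pow p (D z) + ennreal C * lp_pow p (D z)))"
        by (rule mult_left_mono) simp
      also have "\<dots> = ?w z" by (simp add: algebra_simps)
      finally show "ennreal (K z) * lp_pow p (\<lambda>x. D z x - A k (D z) x) \<le> ?w z" .
    qed
    have "(\<integral>\<^sup>+z. ?w z \<partial>lborel)
        = ennreal (2 powr p) * ((1 + ennreal C) * (\<integral>\<^sup>+z. ennreal (K z) * lp_pow p (D z) \<partial>lborel))"
      unfolding D_def by (simp add: nn_integral_cmult)
    also have "\<dots> < \<infinity>"
      using fin by (simp add: energy_def D_def ennreal_mult_less_top)
    finally show "(\<integral>\<^sup>+z. ?w z \<partial>lborel) < \<infinity>" .
    show "AE z in lborel. (\<lambda>k. ennreal (K z) * lp_pow p (\<lambda>x. D z x - A k (D z) x)) \<longlonglongrightarrow> 0"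
    proof (rule AE_I2)
      fix z
      have "(\<lambda>k. ennreal (K z) * lp_pow p (\<lambda>x. D z x - A k (D z) x)) \<longlonglongrightarrow> ennreal (K z) * 0"
        unfolding A_def using p fin_D by (intro ennreal_tendsto_cmult ball_avg_lp_tendsto) auto
      then show "(\<lambda>k. ennreal (K z) * lp_pow p (\<lambda>x. D z x - A k (D z) x)) \<longlonglongrightarrow> 0" by simp
    qed
  qed simp
  then have "(\<lambda>k. lp_pow p (\<lambda>x. g x - A k g x) +
      (\<integral>\<^sup>+z. ennreal (K z) * lp_pow p (\<lambda>x. D z x - A k (D z) x) \<partial>lborel)) \<longlonglongrightarrow> 0 + 0"
    unfolding A_def using p fin_g by (intro tendsto_add ball_avg_lp_tendsto) auto
  then show ?thesis
    unfolding energy_def AD[unfolded A_def] by (simp add: A_def)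
qed

section \<open>Energy of suprema of truncated maximal functions\<close>

lemma lp_pow_le_suminf_of_maximal_bound:
  fixes v :: "nat \<Rightarrow> 'a::euclidean_space \<Rightarrow> real"
  assumes v[measurable]: "\<And>i. v i \<in> borel_measurable borel" and p: "1 < p"
    and le: "\<And>x. ennreal \<bar>\<psi> x\<bar> \<le> (SUP i. local_maximal (\<lambda>y. ennreal \<bar>v i y\<bar>) x)"
  shows "lp_pow p \<psi> \<le> ennreal (maximal_const p DIM('a)) * (\<Sum>i. lp_pow p (v i))"
proof -
  have "lp_pow p \<psi> = (\<integral>\<^sup>+x. epow p (ennreal \<bar>\<psi> x\<bar>) \<partial>lborel)"
    using p by (simp add: lp_pow_def epow_ennreal)
  also have "\<dots> \<le> (\<integral>\<^sup>+x. epow p (SUP i. local_maximal (\<lambda>y. ennreal \<bar>v i y\<bar>) x) \<partial>lborel)"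
    by (intro nn_integral_mono epow_mono le)
  \<comment> \<open>The supremum is paid for by a sum here, before integration, so that the
    strong-type bound applies to each term separately.\<close>
  also have "\<dots> \<le> (\<integral>\<^sup>+x. (\<Sum>i. epow p (local_maximal (\<lambda>y. ennreal \<bar>v i y\<bar>) x)) \<partial>lborel)"
    by (intro nn_integral_mono epow_SUP_le)
  also have "\<dots> = (\<Sum>i. \<integral>\<^sup>+x. epow p (local_maximal (\<lambda>y. ennreal \<bar>v i y\<bar>) x) \<partial>lborel)"
    by (rule nn_integral_suminf) measurable
  also have "\<dots> \<le> (\<Sum>i. ennreal (maximal_const p DIM('a)) * lp_pow p (v i))"
    unfolding lp_pow_def using p by (intro suminf_le local_maximal_strong_type) auto
  finally show ?thesis by simp
qed

lemma local_maximal_le_add_diff: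
  fixes f g :: "'a::euclidean_space \<Rightarrow> real"
  assumes [measurable]: "f \<in> borel_measurable borel" "g \<in> borel_measurable borel"
  shows "local_maximal (\<lambda>y. ennreal \<bar>f y\<bar>) x
    \<le> local_maximal (\<lambda>y. ennreal \<bar>g y\<bar>) x + local_maximal (\<lambda>y. ennreal \<bar>f y - g y\<bar>) x"
proof -
  have "local_maximal (\<lambda>y. ennreal \<bar>f y\<bar>) x \<le> local_maximal (\<lambda>y. ennreal \<bar>g y\<bar> + ennreal \<bar>f y - g y\<bar>) x"
    by (intro local_maximal_mono) (simp flip: ennreal_plus)
  also have "\<dots> \<le> local_maximal (\<lambda>y. ennreal \<bar>g y\<bar>) x + local_maximal (\<lambda>y. ennreal \<bar>f y - g y\<bar>) x"
    by (rule local_maximal_add) measurable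
  finally show ?thesis .
qed

lemma ennreal_abs_diff_le:
  assumes "a \<le> b + s" "b \<le> a + s" "a < \<infinity>" "b < \<infinity>"
  shows "ennreal \<bar>enn2real a - enn2real b\<bar> \<le> s"
  using assms
  by (cases a; cases b; cases s) (auto simp flip: ennreal_plus simp: ennreal_le_iff2)

text \<open>The test function for the capacity. Truncating at 1 inside the supremum keeps the value
  finite, so that \<open>enn2real\<close> loses nothing.\<close>

definition truncated_sup_maximal :: "(nat \<Rightarrow> 'a::euclidean_space \<Rightarrow> real) \<Rightarrow> 'a \<Rightarrow> real" where
  "truncated_sup_maximal h x = enn2real (SUP i. min 1 (local_maximal (\<lambda>y. ennreal \<bar>h i y\<bar>) x))"

lemma borel_measurable_truncated_sup_maximal [measurable]:
  assumes [measurable]: "\<And>i. h i \<in> borel_measurable borel"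
  shows "truncated_sup_maximal h \<in> borel_measurable borel"
  unfolding truncated_sup_maximal_def[abs_def] by measurable

lemma one_le_truncated_sup_maximal:
  assumes "1 < local_maximal (\<lambda>y. ennreal \<bar>h i y\<bar>) x"
  shows "1 \<le> truncated_sup_maximal h x"
proof -
  let ?P = "SUP i. min 1 (local_maximal (\<lambda>y. ennreal \<bar>h i y\<bar>) x)"
  have "min 1 (local_maximal (\<lambda>y. ennreal \<bar>h i y\<bar>) x) \<le> ?P" by (rule SUP_upper) simp
  then have "1 \<le> ?P" using assms by (simp add: min_absorb1)
  moreover have "?P \<le> 1" by (rule SUP_least) simp
  ultimately show ?thesis by (simp add: truncated_sup_maximal_def)
qed

text \<open>Both the function and each of its differences by \<open>z\<close> are dominated by
  suprema of local maximal functions, of \<open>h i\<close> and of the differences of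
  \<open>h i\<close> respectively. The same unweighted bound then controls both parts of the
  energy.\<close>

lemma energy_truncated_sup_maximal_le:
  fixes h :: "nat \<Rightarrow> 'a::euclidean_space \<Rightarrow> real"
  assumes h[measurable]: "\<And>i. h i \<in> borel_measurable borel" and K[measurable]: "K \<in> borel_measurable borel"
    and p: "1 < p"
  shows "energy p K (truncated_sup_maximal h)
    \<le> ennreal (maximal_const p DIM('a)) * (\<Sum>i. energy p K (h i))"
proof -
  define C where "C = ennreal (maximal_const p DIM('a))"
  define u where "u = (\<lambda>i. local_maximal (\<lambda>y. ennreal \<bar>h i y\<bar>))"
  define P where "P = (\<lambda>x. SUP i. min 1 (u i x))"
  define D where "D = (\<lambda>z i x. h i x - h i (x - z))"
  have [measurable]: "D z i \<in> borel_measurable borel" for z i unfolding D_def by measurable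
  have eq: "truncated_sup_maximal h = (\<lambda>x. enn2real (P x))"
    by (simp add: truncated_sup_maximal_def P_def u_def fun_eq_iff)
  have "P x \<le> 1" for x unfolding P_def by (rule SUP_least) simp
  then have P_fin: "P x < \<infinity>" for x using le_less_trans[of "P x" 1 \<infinity>] by simp
  have "ennreal \<bar>truncated_sup_maximal h x\<bar> \<le> (SUP i. u i x)" for x
    unfolding eq using P_fin[of x] by (auto simp: P_def intro!: SUP_mono')
  then have 1: "lp_pow p (truncated_sup_maximal h) \<le> C * (\<Sum>i. lp_pow p (h i))"
    unfolding C_def u_def using p by (intro lp_pow_le_suminf_of_maximal_bound) auto
  \<comment> \<open>Truncation at 1 does not increase distances, in a form that makes sense for
    infinite values.\<close>
  have trunc: "min 1 a \<le> min 1 b + c" if "a \<le> b + c" for a b c :: ennreal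
  proof (cases "b \<le> 1")
    case True
    then show ?thesis using that by (simp add: min_absorb2 min.coboundedI2)
  next
    case False
    then have "min 1 b = 1" by simp
    then show ?thesis by (simp add: min.coboundedI1)
  qed
  have "ennreal \<bar>truncated_sup_maximal h x - truncated_sup_maximal h (x - z)\<bar>
      \<le> (SUP i. local_maximal (\<lambda>y. ennreal \<bar>D z i y\<bar>) x)" for x z
  proof -
    let ?S = "SUP i. local_maximal (\<lambda>y. ennreal \<bar>D z i y\<bar>) x"
    \<comment> \<open>Moving the translation inside the operator lets sublinearity compare two
      maximal functions at the same point \<open>x\<close>.\<close>
    have shift: "u i (x - z) = local_maximal (\<lambda>y. ennreal \<bar>h i (y - z)\<bar>) x" for i
      unfolding u_def by (rule local_maximal_shift[symmetric]) measurable
    have S: "local_maximal (\<lambda>y. ennreal \<bar>D z i y\<bar>) x \<le> ?S" for i by (rule SUP_upper) simp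
    have "u i x \<le> u i (x - z) + local_maximal (\<lambda>y. ennreal \<bar>D z i y\<bar>) x" for i
      unfolding shift unfolding u_def D_def by (rule local_maximal_le_add_diff) measurable
    then have a: "u i x \<le> u i (x - z) + ?S" for i
      using order_trans[OF _ add_left_mono[OF S]] by blast
    have "u i (x - z) \<le> u i x + local_maximal (\<lambda>y. ennreal \<bar>D z i y\<bar>) x" for i
      unfolding shift unfolding u_def D_def
      using local_maximal_le_add_diff[of "\<lambda>y. h i (y - z)" "h i" x] by (simp add: abs_minus_commute)
    then have b: "u i (x - z) \<le> u i x + ?S" for i
      using order_trans[OF _ add_left_mono[OF S]] by blast
    have "P x \<le> P (x - z) + ?S"
      unfolding P_def by (rule SUP_least, rule order_trans[OF trunc[OF a]]) (intro add_right_mono SUP_upper UNIV_I)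
    moreover have "P (x - z) \<le> P x + ?S"
      unfolding P_def by (rule SUP_least, rule order_trans[OF trunc[OF b]]) (intro add_right_mono SUP_upper UNIV_I)
    ultimately show ?thesis
      unfolding eq using P_fin by (intro ennreal_abs_diff_le) auto
  qed
  then have 2: "lp_pow p (\<lambda>x. truncated_sup_maximal h x - truncated_sup_maximal h (x - z))
      \<le> C * (\<Sum>i. lp_pow p (D z i))" for z
    unfolding C_def using p by (intro lp_pow_le_suminf_of_maximal_bound) auto
  have "(\<integral>\<^sup>+z. ennreal (K z) * lp_pow p (\<lambda>x. truncated_sup_maximal h x - truncated_sup_maximal h (x - z)) \<partial>lborel)
      \<le> (\<integral>\<^sup>+z. C * (\<Sum>i. ennreal (K z) * lp_pow p (D z i)) \<partial>lborel)"
  proof (rule nn_integral_mono)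
    fix z
    show "ennreal (K z) * lp_pow p (\<lambda>x. truncated_sup_maximal h x - truncated_sup_maximal h (x - z))
      \<le> C * (\<Sum>i. ennreal (K z) * lp_pow p (D z i))"
      using mult_left_mono[OF 2, of "ennreal (K z)" z] by (simp add: mult.left_commute)
  qed
  also have "\<dots> = C * (\<Sum>i. \<integral>\<^sup>+z. ennreal (K z) * lp_pow p (D z i) \<partial>lborel)"
    unfolding D_def by (simp add: nn_integral_cmult nn_integral_suminf del: ennreal_suminf_cmult)
  finally have 3: "(\<integral>\<^sup>+z. ennreal (K z) * lp_pow p (\<lambda>x. truncated_sup_maximal h x - truncated_sup_maximal h (x - z)) \<partial>lborel)
      \<le> C * (\<Sum>i. \<integral>\<^sup>+z. ennreal (K z) * lp_pow p (D z i) \<partial>lborel)" .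
  have "energy p K (truncated_sup_maximal h) \<le> C * (\<Sum>i. lp_pow p (h i))
      + C * (\<Sum>i. \<integral>\<^sup>+z. ennreal (K z) * lp_pow p (D z i) \<partial>lborel)"
    unfolding energy_def by (intro add_mono 1 3)
  also have "\<dots> = C * (\<Sum>i. energy p K (h i))"
    unfolding energy_def D_def by (simp add: suminf_add[symmetric] distrib_left)
  finally show ?thesis unfolding C_def .
qed

text \<open>Interchange of limits: comparing \<open>b i\<close> and \<open>b j\<close> through
  \<open>a\<close> and letting the radius tend to 0 makes \<open>c\<close> a Cauchy sequence. In the
  application \<open>a\<close> holds the averages of f at a point, and \<open>b i\<close> those of
  its continuous approximants.\<close>

lemma limit_of_uniform_approximations:
  fixes a :: "real \<Rightarrow> real" and b :: "nat \<Rightarrow> real \<Rightarrow> real"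
  assumes b: "\<And>i. k \<le> i \<Longrightarrow> (b i \<longlongrightarrow> c i) (at_right 0)"
    and ab: "\<And>i r. k \<le> i \<Longrightarrow> 0 < r \<Longrightarrow> r \<le> 1 \<Longrightarrow> \<bar>a r - b i r\<bar> \<le> (1 / 2) ^ i"
  obtains L where "(a \<longlongrightarrow> L) (at_right 0)" "\<And>i. k \<le> i \<Longrightarrow> \<bar>c i - L\<bar> \<le> (1 / 2) ^ i"
proof -
  have ev: "eventually (\<lambda>r. 0 < r \<and> r \<le> 1) (at_right (0::real))"
    using eventually_at_right_real[of 0 "1::real"] by (auto elim!: eventually_mono)
  have cc: "\<bar>c i - c j\<bar> \<le> (1 / 2) ^ i + (1 / 2) ^ j" if "k \<le> i" "k \<le> j" for i j
  proof (rule tendsto_upperbound)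
    show "((\<lambda>r. \<bar>b i r - b j r\<bar>) \<longlongrightarrow> \<bar>c i - c j\<bar>) (at_right 0)"
      using that by (intro tendsto_intros b)
    show "eventually (\<lambda>r. \<bar>b i r - b j r\<bar> \<le> (1 / 2) ^ i + (1 / 2) ^ j) (at_right 0)"
      using ev
    proof eventually_elim
      case (elim r)
      then show ?case using ab[of i r] ab[of j r] that by linarith
    qed
  qed simp
  have half: "(\<lambda>i. (1 / 2) ^ i :: real) \<longlonglongrightarrow> 0"
    by (rule LIMSEQ_realpow_zero) auto
  have "Cauchy c"
  proof (rule metric_CauchyI)
    fix e :: real assume "0 < e"
    then have "eventually (\<lambda>i. (1 / 2) ^ i < e / 2) sequentially"
      by (intro order_tendstoD(2)[OF half]) simp
    then obtain M where M: "\<And>i. M \<le> i \<Longrightarrow> (1 / 2) ^ i < e / 2"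
      unfolding eventually_sequentially by blast
    have "dist (c i) (c j) < e" if "max k M \<le> i" "max k M \<le> j" for i j
      using cc[of i j] M[of i] M[of j] that by (simp add: dist_real_def)
    then show "\<exists>M. \<forall>m\<ge>M. \<forall>n\<ge>M. dist (c m) (c n) < e" by blast
  qed
  then obtain L where L: "c \<longlonglongrightarrow> L" unfolding Cauchy_convergent_iff convergent_def by blast
  have cL: "\<bar>c i - L\<bar> \<le> (1 / 2) ^ i" if "k \<le> i" for i
  proof (rule tendsto_le[OF sequentially_bot])
    show "(\<lambda>j. (1 / 2) ^ i + (1 / 2) ^ j :: real) \<longlonglongrightarrow> (1 / 2) ^ i"
      using tendsto_add[OF tendsto_const half, of "(1 / 2) ^ i"] by simp
    show "(\<lambda>j. \<bar>c i - c j\<bar>) \<longlonglongrightarrow> \<bar>c i - L\<bar>" by (intro tendsto_intros L)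
    show "eventually (\<lambda>j. \<bar>c i - c j\<bar> \<le> (1 / 2) ^ i + (1 / 2) ^ j) sequentially"
      using eventually_ge_at_top[of k] by eventually_elim (use cc that in auto)
  qed
  have "(a \<longlongrightarrow> L) (at_right 0)"
  proof (rule tendstoI)
    fix e :: real assume "0 < e"
    then have "eventually (\<lambda>i. (1 / 2) ^ i < e / 3) sequentially"
      by (intro order_tendstoD(2)[OF half]) simp
    then have "eventually (\<lambda>i. k \<le> i \<and> (1 / 2) ^ i < e / 3) sequentially"
      using eventually_ge_at_top[of k] by eventually_elim simp
    then obtain i where i: "k \<le> i" "(1 / 2) ^ i < e / 3"
      unfolding eventually_sequentially by blast
    have "eventually (\<lambda>r. dist (b i r) (c i) < e / 3) (at_right 0)"
      using b[OF i(1)] \<open>0 < e\<close> by (intro tendstoD) auto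
    then show "eventually (\<lambda>r. dist (a r) L < e) (at_right 0)"
      using ev
    proof eventually_elim
      case (elim r)
      then have "\<bar>a r - b i r\<bar> \<le> (1 / 2) ^ i" using ab[OF i(1)] by blast
      then show ?case using elim(1) cL[OF i(1)] i(2) unfolding dist_real_def by linarith
    qed
  qed
  then show ?thesis using cL by (rule that)
qed

section \<open>Quasicontinuity\<close>

text \<open>The factor 2 in the energy bound is the geometric tail, the sum of (1/2)^i over i \<ge>
  k being 2 (1/2)^k. One function \<open>l\<close> serves every \<open>U k\<close>, so the limit
  exists off the intersection of these sets.\<close>

lemma quasicontinuous_representative:
  fixes f :: "'a::euclidean_space \<Rightarrow> real"
  assumes f[measurable]: "f \<in> borel_measurable borel" and K[measurable]: "K \<in> borel_measurable borel"
    and p: "1 < p" and fin: "energy p K f < \<infinity>"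
  obtains U :: "nat \<Rightarrow> 'a set" and \<phi> l where
    "\<And>k. open (U k)" "\<And>k. \<phi> k \<in> borel_measurable borel"
    "\<And>k x. x \<in> U k \<Longrightarrow> 1 \<le> \<phi> k x"
    "\<And>k. energy p K (\<phi> k) \<le> ennreal (2 * (1 / 2) ^ k)"
    "\<And>k x. x \<notin> U k \<Longrightarrow> ((\<lambda>r. ball_avg r f x) \<longlongrightarrow> l x) (at_right 0)"
    "\<And>k. continuous_on (- U k) l"
proof -
  define C where "C = maximal_const p DIM('a)"
  have C: "0 \<le> C" using p by (simp add: C_def maximal_const_nonneg)
  define A where "A = (\<lambda>n. ball_avg (1 / real (Suc n)) f)"
  have [measurable]: "A n \<in> borel_measurable borel" for n unfolding A_def by measurable
  \<comment> \<open>Dividing by \<open>C + 1\<close> keeps the target positive knowing only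
    \<open>0 \<le> C\<close>, and the factor \<open>C / (C + 1)\<close> that later appears is at
    most 1.\<close>
  have "\<exists>n. energy p K (\<lambda>x. 2 ^ i * (f x - A n x)) \<le> ennreal ((1 / 2) ^ i / (C + 1))" for i :: nat
  proof -
    have "(\<lambda>n. ennreal (\<bar>2 ^ i\<bar> powr p) * energy p K (\<lambda>x. f x - A n x)) \<longlonglongrightarrow> ennreal (\<bar>2 ^ i\<bar> powr p) * 0"
      unfolding A_def using p fin by (intro ennreal_tendsto_cmult energy_ball_avg_tendsto) auto
    moreover have "0 < ennreal ((1 / 2) ^ i / (C + 1))" using C by simp
    ultimately have "eventually (\<lambda>n. ennreal (\<bar>2 ^ i\<bar> powr p) * energy p K (\<lambda>x. f x - A n x)
        < ennreal ((1 / 2) ^ i / (C + 1))) sequentially"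
      by (intro order_tendstoD(2)) auto
    then obtain n where "ennreal (\<bar>2 ^ i\<bar> powr p) * energy p K (\<lambda>x. f x - A n x)
        < ennreal ((1 / 2) ^ i / (C + 1))"
      unfolding eventually_sequentially by blast
    moreover have "energy p K (\<lambda>x. 2 ^ i * (f x - A n x))
        = ennreal (\<bar>2 ^ i\<bar> powr p) * energy p K (\<lambda>x. f x - A n x)"
      by (rule energy_cmult) measurable
    ultimately show ?thesis by (metis less_imp_le)
  qed
  then obtain n where n: "\<And>i. energy p K (\<lambda>x. 2 ^ i * (f x - A (n i) x)) \<le> ennreal ((1 / 2) ^ i / (C + 1))"
    by metis
  define h where "h = (\<lambda>i x. 2 ^ i * (f x - A (n i) x))"
  have h[measurable]: "h i \<in> borel_measurable borel" for i unfolding h_def by measurable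
  define u where "u = (\<lambda>i. local_maximal (\<lambda>y. ennreal \<bar>h i y\<bar>))"
  define U where "U = (\<lambda>k. \<Union>j. {x. 1 < u (j + k) x})"
  define \<phi> where "\<phi> = (\<lambda>k. truncated_sup_maximal (\<lambda>j. h (j + k)))"
  \<comment> \<open>Defined without reference to \<open>k\<close>; it is meaningful only at points
    outside some \<open>U k\<close>.\<close>
  define l where "l = (\<lambda>x. Lim (at_right 0) (\<lambda>r. ball_avg r f x))"
  have "lp_pow p f < \<infinity>" using fin by (auto simp: energy_def)
  then have int: "ball_integrable f" using p by (intro ball_integrable_lp[where p = p]) auto
  have A_cont: "continuous_on UNIV (A i)" for i
    unfolding A_def by (intro continuous_on_ball_avg int) auto
  have approx: "((\<lambda>r. ball_avg r f x) \<longlongrightarrow> l x) (at_right 0) \<and> (\<forall>i\<ge>k. \<bar>A (n i) x - l x\<bar> \<le> (1 / 2) ^ i)"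
    if x: "x \<notin> U k" for x k
  proof -
    obtain L where L: "((\<lambda>r. ball_avg r f x) \<longlongrightarrow> L) (at_right 0)"
      "\<And>i. k \<le> i \<Longrightarrow> \<bar>A (n i) x - L\<bar> \<le> (1 / 2) ^ i"
    proof (rule limit_of_uniform_approximations)
      show "((\<lambda>r. ball_avg r (A (n i)) x) \<longlongrightarrow> A (n i) x) (at_right 0)" for i
        by (rule ball_avg_tendsto[OF A_cont])
      fix i r assume i: "k \<le> i" and r: "0 < r" "(r :: real) \<le> 1"
      have "ball_avg r (h i) x = 2 ^ i * ball_avg r (\<lambda>y. f y - A (n i) y) x"
        unfolding ball_avg_def h_def mult.left_commute[of _ "2 ^ i"] by simp
      also have "\<dots> = 2 ^ i * (ball_avg r f x - ball_avg r (A (n i)) x)"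
        by (simp add: ball_avg_diff[OF int ball_integrable_continuous[OF A_cont]])
      finally have eq: "ball_avg r (h i) x = 2 ^ i * (ball_avg r f x - ball_avg r (A (n i)) x)" .
      \<comment> \<open>An index \<open>i\<close> beyond \<open>k\<close> occurs in the union
        defining \<open>U k\<close> as j = i - k.\<close>
      have "u i x \<le> 1" using x i unfolding U_def by (auto simp: not_less dest: spec[of _ "i - k"])
      then have "ennreal \<bar>ball_avg r (h i) x\<bar> \<le> 1"
        using abs_ball_avg_le_local_maximal[OF r, of "h i" x] unfolding u_def by (rule order_trans[rotated])
      then have "2 ^ i * \<bar>ball_avg r f x - ball_avg r (A (n i)) x\<bar> \<le> 1"
        by (simp add: eq abs_mult)
      then show "\<bar>ball_avg r f x - ball_avg r (A (n i)) x\<bar> \<le> (1 / 2) ^ i"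
        by (simp add: field_simps power_one_over)
    qed blast
    then have "l x = L" unfolding l_def by (intro tendsto_Lim) auto
    then show ?thesis using L by blast
  qed
  show ?thesis
  proof (rule that)
    show "open (U k)" for k
      unfolding U_def u_def by (intro open_UN ballI open_local_maximal_gt) measurable
    show "\<phi> k \<in> borel_measurable borel" for k
      unfolding \<phi>_def by measurable
    show "1 \<le> \<phi> k x" if "x \<in> U k" for k x
    proof -
      from that obtain j where "1 < u (j + k) x" by (auto simp: U_def)
      then show ?thesis
        unfolding \<phi>_def u_def by (rule one_le_truncated_sup_maximal[where h = "\<lambda>j. h (j + k)"])
    qed
    show "energy p K (\<phi> k) \<le> ennreal (2 * (1 / 2) ^ k)" for k
    proof -
      have "energy p K (\<phi> k) \<le> ennreal C * (\<Sum>j. energy p K (h (j + k)))"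
        unfolding \<phi>_def C_def using p by (intro energy_truncated_sup_maximal_le) auto
      also have "\<dots> \<le> ennreal C * (\<Sum>j. ennreal ((1 / 2) ^ k / (C + 1) * (1 / 2) ^ j))"
      proof (intro mult_left_mono suminf_le)
        fix j
        have "energy p K (h (j + k)) \<le> ennreal ((1 / 2) ^ (j + k) / (C + 1))"
          using n[of "j + k"] by (simp only: h_def)
        then show "energy p K (h (j + k)) \<le> ennreal ((1 / 2) ^ k / (C + 1) * (1 / 2) ^ j)"
          by (simp add: power_add mult.commute)
      qed auto
      also have "(\<Sum>j. ennreal ((1 / 2) ^ k / (C + 1) * (1 / 2) ^ j)) = ennreal ((1 / 2) ^ k / (C + 1) * 2)"
      proof (rule suminf_ennreal_eq)
        show "(\<lambda>j. (1 / 2) ^ k / (C + 1) * (1 / 2) ^ j) sums ((1 / 2) ^ k / (C + 1) * 2)"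
          using sums_mult[OF geometric_sums[of "1 / 2 :: real"], of "(1 / 2) ^ k / (C + 1)"] by simp
      qed (use C in auto)
      also have "ennreal C * \<dots> = ennreal (2 * (1 / 2) ^ k * (C / (C + 1)))"
        using C by (simp add: mult_ac flip: ennreal_mult)
      also have "\<dots> \<le> ennreal (2 * (1 / 2) ^ k)"
        using C by (intro ennreal_leI mult_right_le_one_le) auto
      finally show ?thesis .
    qed
    show "((\<lambda>r. ball_avg r f x) \<longlongrightarrow> l x) (at_right 0)" if "x \<notin> U k" for k x
      using approx[OF that] by simp
    show "continuous_on (- U k) l" for k
    \<comment> \<open>The error bound (1/2)^i does not depend on the point outside
      \<open>U k\<close>, so \<open>l\<close> is there a uniform limit of continuous
      averages.\<close>
    proof (rule uniform_limit_theorem)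
      show "eventually (\<lambda>i. continuous_on (- U k) (A (n i))) sequentially"
        by (intro always_eventually allI continuous_on_subset[OF A_cont]) simp
      show "uniform_limit (- U k) (\<lambda>i. A (n i)) l sequentially"
      proof (rule uniform_limitI)
        fix e :: real assume "0 < e"
        have "(\<lambda>i. (1 / 2) ^ i :: real) \<longlonglongrightarrow> 0" by (rule LIMSEQ_realpow_zero) auto
        from order_tendstoD(2)[OF this \<open>0 < e\<close>] eventually_ge_at_top[of k]
        show "eventually (\<lambda>i. \<forall>x\<in>- U k. dist (A (n i) x) (l x) < e) sequentially"
        proof eventually_elim
          case (elim i)
          show ?case
          proof
            fix x assume "x \<in> - U k"
            then have "\<bar>A (n i) x - l x\<bar> \<le> (1 / 2) ^ i" using approx elim by blast
            then show "dist (A (n i) x) (l x) < e" using elim unfolding dist_real_def by linarith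
          qed
        qed
      qed
    qed simp
  qed
qed

section \<open>Borel representatives and the identification of the Sobolev norm with the
  energy\<close>

lemma distr_lborel_reflect: "distr lborel borel (\<lambda>y. t - y) = (lborel :: 'a::euclidean_space measure)"
  using lborel_affine[of "-1" t] by (simp add: density_1)

text \<open>Local integrability contains measurability on each ball, and the restrictions to growing
  balls are eventually constant at every point.\<close>

lemma weight_borel_measurable:
  fixes \<omega> :: "real ^ 'n \<Rightarrow> real"
  assumes "weight \<omega>"
  shows "\<omega> \<in> borel_measurable lebesgue"
proof (rule borel_measurable_LIMSEQ_real)
  show "(\<lambda>x. indicator (cball 0 (real n)) x *\<^sub>R \<omega> x) \<in> borel_measurable lebesgue" for n
    using assms unfolding weight_def set_integrable_def
    by (metis borel_measurable_integrable compact_cball)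
  fix x :: "real ^ 'n"
  obtain N :: nat where "norm x \<le> real N" using real_arch_simple by blast
  then have "\<forall>n\<ge>N. indicator (cball 0 (real n)) x *\<^sub>R \<omega> x = \<omega> x"
    by (auto simp: indicator_def)
  then show "(\<lambda>n. indicator (cball 0 (real n)) x *\<^sub>R \<omega> x) \<longlonglongrightarrow> \<omega> x"
    by (intro tendsto_eventually) (auto simp: eventually_sequentially)
qed

text \<open>Exceptional null sets are dealt with one variable at a time: almost every
  \<open>x\<close> is fixed first, and then almost every \<open>y\<close>. Only after the passage to
  Borel functions is Tonelli applied, to put the integral in z = x - y outside.\<close>

lemma sobolev_norm_pow_eq_energy:
  fixes \<omega> w f g :: "real ^ 'n \<Rightarrow> real"
  assumes w[measurable]: "w \<in> borel_measurable borel" and g[measurable]: "g \<in> borel_measurable borel"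
    and \<omega>w: "AE x in lborel. \<omega> x = w x" and fg: "AE x in lborel. f x = g x"
  shows "sobolev_norm_pow s p \<omega> f = energy p (\<lambda>z. w z / norm z powr (s * p)) g"
proof -
  define H where "H = (\<lambda>x y. ennreal (\<bar>g x - g y\<bar> powr p / norm (x - y) powr (s * p) * w (x - y)))"
  \<comment> \<open>Holds for every \<open>x\<close>, because the reflection y -> x - y preserves
    Lebesgue measure and hence null sets.\<close>
  have \<omega>w': "AE y in lborel. \<omega> (x - y) = w (x - y)" for x
  proof -
    have "AE y in distr lborel borel (\<lambda>y. x - y). \<omega> y = w y"
      unfolding distr_lborel_reflect by (rule \<omega>w)
    then show ?thesis by (rule AE_distrD[rotated]) measurable
  qed
  have "seminorm_pow s p \<omega> f = (\<integral>\<^sup>+x. (\<integral>\<^sup>+y.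
      ennreal (\<bar>f x - f y\<bar> powr p / norm (x - y) powr (s * p) * \<omega> (x - y)) \<partial>lborel) \<partial>lborel)"
    by (simp add: seminorm_pow_def nn_integral_completion)
  also have "\<dots> = (\<integral>\<^sup>+x. (\<integral>\<^sup>+y. H x y \<partial>lborel) \<partial>lborel)"
  proof (rule nn_integral_cong_AE)
    show "AE x in lborel. (\<integral>\<^sup>+y.
      ennreal (\<bar>f x - f y\<bar> powr p / norm (x - y) powr (s * p) * \<omega> (x - y)) \<partial>lborel)
      = (\<integral>\<^sup>+y. H x y \<partial>lborel)"
      using fg
    proof eventually_elim
      case (elim x)
      show ?case
      proof (rule nn_integral_cong_AE)
        show "AE y in lborel. ennreal (\<bar>f x - f y\<bar> powr p / norm (x - y) powr (s * p) * \<omega> (x - y)) = H x y"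
          using fg \<omega>w'[of x] by eventually_elim (simp add: H_def elim)
      qed
    qed
  qed
  also have "\<dots> = (\<integral>\<^sup>+x. (\<integral>\<^sup>+z. H x (x - z) \<partial>lborel) \<partial>lborel)"
  proof (rule nn_integral_cong)
    fix x
    have "(\<integral>\<^sup>+y. H x y \<partial>distr lborel borel (\<lambda>z. x - z)) = (\<integral>\<^sup>+z. H x (x - z) \<partial>lborel)"
      unfolding H_def by (rule nn_integral_distr) measurable
    then show "(\<integral>\<^sup>+y. H x y \<partial>lborel) = (\<integral>\<^sup>+z. H x (x - z) \<partial>lborel)"
      by (simp add: distr_lborel_reflect)
  qed
  also have "\<dots> = (\<integral>\<^sup>+x. (\<integral>\<^sup>+z. ennreal (w z / norm z powr (s * p)) *
      ennreal (\<bar>g x - g (x - z)\<bar> powr p) \<partial>lborel) \<partial>lborel)"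
    by (simp add: H_def mult.commute flip: ennreal_mult'')
  also have "\<dots> = (\<integral>\<^sup>+z. (\<integral>\<^sup>+x. ennreal (w z / norm z powr (s * p)) *
      ennreal (\<bar>g x - g (x - z)\<bar> powr p) \<partial>lborel) \<partial>lborel)"
    by (rule lborel_pair.Fubini') measurable
  also have "\<dots> = (\<integral>\<^sup>+z. ennreal (w z / norm z powr (s * p)) * lp_pow p (\<lambda>x. g x - g (x - z)) \<partial>lborel)"
    by (simp add: lp_pow_def nn_integral_cmult)
  finally have "seminorm_pow s p \<omega> f = \<dots>" .
  moreover have "Lp_norm_pow p f = lp_pow p g"
    unfolding Lp_norm_pow_def lp_pow_def nn_integral_completion
    using fg by (intro nn_integral_cong_AE) (auto elim: eventually_mono)
  ultimately show ?thesis by (simp add: sobolev_norm_pow_def energy_def)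
qed

text \<open>A change on a null set alters no integral, so the averages agree at every centre
  although the functions agree only a.e.; limits therefore transfer at each single point.\<close>

lemma mean_on_ball_eq_ball_avg:
  fixes f g :: "real ^ 'n \<Rightarrow> real"
  assumes f: "f \<in> borel_measurable lebesgue" and g: "g \<in> borel_measurable borel"
    and fg: "AE x in lborel. f x = g x"
  shows "mean_on (ball x r) f = ball_avg r g x"
proof -
  have meas: "(\<lambda>y. indicator (ball x r) y * g y) \<in> borel_measurable borel"
    using g by (intro borel_measurable_times borel_measurable_indicator) auto
  have "(LINT y:ball x r|lebesgue. f y) = (\<integral>y. indicator (ball x r) y * g y \<partial>lebesgue)"
    unfolding set_lebesgue_integral_def
  proof (rule integral_cong_AE)
    show "(\<lambda>y. indicator (ball x r) y *\<^sub>R f y) \<in> borel_measurable lebesgue"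
      using f by (intro borel_measurable_scaleR borel_measurable_indicator) auto
    show "(\<lambda>y. indicator (ball x r) y * g y) \<in> borel_measurable lebesgue"
      using meas by (intro measurable_completion) simp
    have "AE x in lebesgue. f x = g x" using fg by (simp add: AE_completion_iff)
    then show "AE y in lebesgue. indicator (ball x r) y *\<^sub>R f y = indicator (ball x r) y * g y"
      by eventually_elim simp
  qed
  also have "\<dots> = (\<integral>y. indicator (ball x r) y * g y \<partial>lborel)"
    using meas by (intro integral_completion) simp
  finally show ?thesis
    by (simp add: mean_on_def ball_avg_def)
qed

theorem theorem6p2:
  fixes s p :: real and \<omega> :: "real ^ 'n \<Rightarrow> real"
  assumes "0 < s" and "s < 1" and "1 < p"
    and "A_p_weight p \<omega>"
    and "C0_infinity \<subseteq> sobolev_space s p \<omega>"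
  shows "\<forall>f \<in> sobolev_space s p \<omega>.
    (\<exists>E. gdelta_in euclidean E \<and> sobolev_capacity s p \<omega> E = 0 \<and>
         (\<forall>x \<in> UNIV - E. has_star_limit f x)) \<and>
    (\<forall>\<epsilon>>0. \<exists>U. open U \<and> sobolev_capacity s p \<omega> U < ennreal \<epsilon> \<and>
         (\<forall>x \<in> UNIV - U. has_star_limit f x) \<and>
         continuous_on (UNIV - U) (star f))"
proof
  fix f assume f: "f \<in> sobolev_space s p \<omega>"
  then have f_meas: "f \<in> borel_measurable lebesgue" by (simp add: sobolev_space_def)
  have "\<omega> \<in> borel_measurable lebesgue"
    using assms(4) by (auto simp: A_p_weight_def intro: weight_borel_measurable)
  then obtain w where w: "w \<in> borel_measurable borel" "AE x in lborel. \<omega> x = w x"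
    using completion_ex_borel_measurable_real[of \<omega> lborel] by auto
  obtain g where g: "g \<in> borel_measurable borel" "AE x in lborel. f x = g x"
    using f_meas completion_ex_borel_measurable_real[of f lborel] by auto
  define K where "K = (\<lambda>z. w z / norm z powr (s * p))"
  have K: "K \<in> borel_measurable borel" unfolding K_def using w(1) by measurable
  have fin: "energy p K g < \<infinity>"
    using f unfolding K_def sobolev_space_def
    by (simp flip: sobolev_norm_pow_eq_energy[OF w(1) g(1) w(2) g(2)])
  obtain U :: "nat \<Rightarrow> (real ^ 'n) set" and \<phi> l where
    U: "\<And>k. open (U k)" and \<phi>: "\<And>k. \<phi> k \<in> borel_measurable borel"
    "\<And>k x. x \<in> U k \<Longrightarrow> 1 \<le> \<phi> k x"
    "\<And>k. energy p K (\<phi> k) \<le> ennreal (2 * (1 / 2) ^ k)"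
    and lim: "\<And>k x. x \<notin> U k \<Longrightarrow> ((\<lambda>r. ball_avg r g x) \<longlongrightarrow> l x) (at_right 0)"
    and cont: "\<And>k. continuous_on (- U k) l"
    using quasicontinuous_representative[OF g(1) K assms(3) fin] by blast
  \<comment> \<open>\<open>\<phi> k\<close> is admissible for every subset of \<open>U k\<close>,
    with \<open>U k\<close> itself as the open neighbourhood. This covers both \<open>U k\<close>
    and the intersection of all these sets.\<close>
  have cap: "sobolev_capacity s p \<omega> E \<le> ennreal (2 * (1 / 2) ^ k)" if "E \<subseteq> U k" for E k
  proof -
    have norm: "sobolev_norm_pow s p \<omega> (\<phi> k) = energy p K (\<phi> k)"
      unfolding K_def using w \<phi>(1) by (intro sobolev_norm_pow_eq_energy) auto
    then have "sobolev_norm_pow s p \<omega> (\<phi> k) < \<infinity>"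
      using le_less_trans[OF \<phi>(3), of k \<infinity>] by simp
    then have "\<phi> k \<in> sobolev_space s p \<omega>"
      using measurable_completion[of "\<phi> k" lborel borel] \<phi>(1) by (simp add: sobolev_space_def)
    moreover have "open (U k) \<and> E \<subseteq> U k \<and> (\<forall>x\<in>U k. \<phi> k x \<ge> 1)"
      using that U \<phi>(2) by simp
    ultimately have "\<phi> k \<in> admissible s p \<omega> E"
      unfolding admissible_def by blast
    then have "sobolev_capacity s p \<omega> E \<le> sobolev_norm_pow s p \<omega> (\<phi> k)"
      unfolding sobolev_capacity_def by (rule INF_lower)
    then show ?thesis using \<phi>(3)[of k] norm by simp
  qed
  have star_lim: "((\<lambda>r. mean_on (ball x r) f) \<longlongrightarrow> l x) (at_right 0)" if "x \<notin> U k" for x k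
    using lim[OF that] by (simp add: mean_on_ball_eq_ball_avg[OF f_meas g])
  have star: "has_star_limit f x" "star f x = l x" if "x \<notin> U k" for x k
    using star_lim[OF that] tendsto_Lim[OF _ star_lim[OF that]]
    unfolding has_star_limit_def star_def by auto
  have half: "(\<lambda>k. 2 * (1 / 2) ^ k :: real) \<longlonglongrightarrow> 0"
    using tendsto_mult_left[OF LIMSEQ_realpow_zero[of "1 / 2 :: real"], of 2] by simp
  have small: "\<exists>k. 2 * (1 / 2) ^ k < e" if "0 < e" for e :: real
    using order_tendstoD(2)[OF half that] unfolding eventually_sequentially by blast
  show "(\<exists>E. gdelta_in euclidean E \<and> sobolev_capacity s p \<omega> E = 0 \<and>
         (\<forall>x \<in> UNIV - E. has_star_limit f x)) \<and>
    (\<forall>\<epsilon>>0. \<exists>U. open U \<and> sobolev_capacity s p \<omega> U < ennreal \<epsilon> \<and>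
         (\<forall>x \<in> UNIV - U. has_star_limit f x) \<and>
         continuous_on (UNIV - U) (star f))"
  proof (intro conjI allI impI)
    \<comment> \<open>The intersection lies in each \<open>U k\<close>, which bounds its capacity by
      every term of a null sequence.\<close>
    have "gdelta_in euclidean (\<Inter>k. U k)"
      using U by (intro gdelta_in_Inter) (auto intro: open_imp_gdelta_in)
    moreover have "sobolev_capacity s p \<omega> (\<Inter>k. U k) = 0"
    proof -
      have "(\<lambda>k. ennreal (2 * (1 / 2) ^ k)) \<longlonglongrightarrow> ennreal 0" by (rule tendsto_ennrealI[OF half])
      moreover have "sobolev_capacity s p \<omega> (\<Inter>k. U k) \<le> ennreal (2 * (1 / 2) ^ k)" for k
        by (intro cap INF_lower UNIV_I)
      ultimately have "sobolev_capacity s p \<omega> (\<Inter>k. U k) \<le> ennreal 0"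
        by (intro LIMSEQ_le_const) auto
      then show ?thesis by simp
    qed
    ultimately show "\<exists>E. gdelta_in euclidean E \<and> sobolev_capacity s p \<omega> E = 0 \<and>
         (\<forall>x \<in> UNIV - E. has_star_limit f x)"
      using star(1) by (intro exI[of _ "\<Inter>k. U k"]) auto
  next
    fix \<epsilon> :: real assume "0 < \<epsilon>"
    then obtain k where k: "2 * (1 / 2) ^ k < \<epsilon>" using small by blast
    have "sobolev_capacity s p \<omega> (U k) < ennreal \<epsilon>"
      using cap[of "U k" k] k \<open>0 < \<epsilon>\<close> by (auto simp: ennreal_lessI intro: le_less_trans)
    \<comment> \<open>\<open>star f\<close> is known to equal \<open>l\<close> only off
      \<open>U k\<close>, so continuity is transferred by congruence on that set.\<close>
    moreover have "continuous_on (- U k) (star f)"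
      using cont[of k] star(2)[of _ k] by (simp cong: continuous_on_cong_simp)
    ultimately show "\<exists>U. open U \<and> sobolev_capacity s p \<omega> U < ennreal \<epsilon> \<and>
         (\<forall>x \<in> UNIV - U. has_star_limit f x) \<and> continuous_on (UNIV - U) (star f)"
      using U[of k] star(1)[of _ k] by (intro exI[of _ "U k"]) (auto simp: Compl_eq_Diff_UNIV)
  qed
qed

end
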